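(* For any set $X$, the free binomial graded algebra $\mathsf T=\mathsf T(X)$ (with its cup-one products) is a binomial $\cup_1$-dga over $\mathbb Z$, with a differential $d_{\mathsf T}$ satisfying $d_{\mathsf T}(x)=0$ for all $x\in X$.
   Context: $\mathrm{Int}(\mathbb Z^X)=\{q\in\mathbb Q[X]: q(\mathbb Z^X)\subseteq\mathbb Z\}$ is the ring of integer-valued polynomials in the variables $X$, and $\mathfrak m_X$ is its ideal of polynomials without constant term. The free binomial graded algebra on $X$ is the tensor algebra $\mathsf T(X)=T^*(\mathfrak m_X)$ over $\mathbb Z$, so $\mathsf T^0=\mathbb Z$, $\mathsf T^1=\mathfrak m_X$ and the cup product is $\otimes$. Its cup-one products are: $\mathsf T^1\otimes\mathsf T^1\to\mathsf T^1$, $a\cup_1 b=ab$ (product of polynomials), and $\mathsf T^2\otimes\mathsf T^1\to\mathsf T^2$, $(a\otimes b)\cup_1 c=ac\otimes b+a\otimes bc$. The map $\circ\colon\mathsf T^2\otimes\mathsf T^2\to\mathsf T^2$ is $(a_1\otimes a_2)\circ(b_1\otimes b_2)=(a_1b_1)\otimes(a_2b_2)$. A binomial ring is a commutative unital ring $B$, torsion-free as a $\mathbb Z$-module, such that $\binom{b}{n}=b(b-1)\cdots(b-n+1)/n!\in B\otimes\mathbb Q$ lies in $B$ for all $b\in B$, $n>0$; write $\zeta_n(b)=\binom bn$ and $\zeta_0(b)=1$. Graded $R$-algebras $A=\bigoplus_{i\ge0}A^i$ are associative and unital, with injective structure map $R\to A$, so that $R\subset A^0$; the product is denoted $a\cup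 b$. A differential graded $R$-algebra (dga) is a graded $R$-algebra with an $R$-linear degree $1$ map $d$ with $d^2=0$ and $d(a\cup b)=da\cup b+(-1)^{|a|}a\cup db$ for homogeneous $a,b$. $D^2(A)\subseteq A^2$ is the $R$-submodule spanned by all $a\cup b$ with $a,b\in A^1$. A graded algebra with cup-one products is a graded $R$-algebra $A$ with $R$-linear maps $\cup_1\colon A^p\otimes_R A^1\to A^p$ for $p=1,2$ such that (i) $(a\cup b)\cup_1 c=a\cup(b\cup_1 c)+(a\cup_1 c)\cup b$ for all $a,b,c\in A^1$; (ii) the $R$-module $R\oplus A^1$, with multiplication $(r+a)(s+b)=rs+(rb+sa+a\cup_1 b)$, is a commutative ring. A $\cup_1$-dga is a differential graded $R$-algebra $(A,d)$ such that $A$ is a graded algebra with cup-one products, there is an $R$-linear map $\circ\colon D^2(A)\otimes_R D^2(A)\to D^2(A)$ with $(u\cup v)\circ(w\cup z)=(u\cup_1 w)\cup(v\cup_1 z)$ for all $u,v,w,z\in A^1$, and $d(a\cup_1 b)=-a\cup b-b\cup a+da\cup_1 b+db\cup_1 a-da\circ db$ for all $a,b\in A^1$ with $da,db\in D^2(A)$. A binomial $\cup_1$-dga over a binomial ring $R$ is a $\cup_1$-dga $(A,d)$ over $R$ such that the commutative ring $R\oplus A^1$ (with $\cup_1$ as multiplication on $A^1$) is a binomial ring. *)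

theory Defs
  imports
    "HOL-Algebra.Free_Abelian_Groups" "HOL-Algebra.Generated_Groups" "HOL-Algebra.QuotRing"
    "HOL-Algebra.IntRing" "HOL-Algebra.Module" "HOL-Library.Poly_Mapping" "HOL.Hull"
begin

section \<open>Binomial rings\<close>

text \<open>The tensor product over the integers of two abelian groups, written multiplicatively
  as in the library's theory of free abelian groups.\<close>

definition tensor_relations ::
    "('a, 'm) monoid_scheme \<Rightarrow> ('b, 'n) monoid_scheme \<Rightarrow> (('a \<times> 'b) \<Rightarrow>\<^sub>0 int) set" where
  "tensor_relations G H =
     {frag_of (x \<otimes>\<^bsub>G\<^esub> x', y) - frag_of (x, y) - frag_of (x', y) | x x' y.
        x \<in> carrier G \<and> x' \<in> carrier G \<and> y \<in> carrier H} \<union>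
     {frag_of (x, y \<otimes>\<^bsub>H\<^esub> y') - frag_of (x, y) - frag_of (x, y') | x y y'.
        x \<in> carrier G \<and> y \<in> carrier H \<and> y' \<in> carrier H}"

definition tensor_kernel ::
    "('a, 'm) monoid_scheme \<Rightarrow> ('b, 'n) monoid_scheme \<Rightarrow> (('a \<times> 'b) \<Rightarrow>\<^sub>0 int) set" where
  "tensor_kernel G H =
     generate (free_Abelian_group (carrier G \<times> carrier H)) (tensor_relations G H)"

definition tensor_product ::
    "('a, 'm) monoid_scheme \<Rightarrow> ('b, 'n) monoid_scheme \<Rightarrow> (('a \<times> 'b) \<Rightarrow>\<^sub>0 int) set monoid" where
  "tensor_product G H = free_Abelian_group (carrier G \<times> carrier H) Mod tensor_kernel G H"

definition pure_tensor ::
    "('a, 'm) monoid_scheme \<Rightarrow> ('b, 'n) monoid_scheme \<Rightarrow> 'a \<Rightarrow> 'b \<Rightarrow> (('a \<times> 'b) \<Rightarrow>\<^sub>0 int) set" where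
  "pure_tensor G H x y =
     tensor_kernel G H #>\<^bsub>free_Abelian_group (carrier G \<times> carrier H)\<^esub> frag_of (x, y)"

definition rat_group :: "rat monoid" where
  "rat_group = \<lparr>carrier = UNIV, monoid.mult = (+), monoid.one = 0\<rparr>"

definition falling_factorial :: "('b, 'm) ring_scheme \<Rightarrow> 'b \<Rightarrow> nat \<Rightarrow> 'b" where
  "falling_factorial B b n = finprod B (\<lambda>i. b \<ominus>\<^bsub>B\<^esub> ([i] \<cdot>\<^bsub>B\<^esub> \<one>\<^bsub>B\<^esub>)) {..<n}"

text \<open>The last condition says that \<open>b (b - 1) \<dots> (b - n + 1) \<otimes> 1/n!\<close>, as an element of the
  tensor product of \<open>B\<close> with the rationals, is in the image of \<open>B\<close> under \<open>c \<mapsto> c \<otimes> 1\<close>.\<close>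

definition binomial_ring :: "('b, 'm) ring_scheme \<Rightarrow> bool" where
  "binomial_ring B \<longleftrightarrow>
     cring B \<and>
     (\<forall>b \<in> carrier B. \<forall>n::nat. n > 0 \<longrightarrow> [n] \<cdot>\<^bsub>B\<^esub> b = \<zero>\<^bsub>B\<^esub> \<longrightarrow> b = \<zero>\<^bsub>B\<^esub>) \<and>
     (\<forall>b \<in> carrier B. \<forall>n::nat. n > 0 \<longrightarrow>
        pure_tensor (add_monoid B) rat_group (falling_factorial B b n) (1 / fact n)
          \<in> (\<lambda>c. pure_tensor (add_monoid B) rat_group c 1) ` carrier B)"


section \<open>Differential graded algebras\<close>

text \<open>An \<open>R\<close>-linear map out of a tensor product of two submodules is given as the
  corresponding \<open>R\<close>-bilinear map.\<close>

definition bilinear_on ::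
    "('r, 'm) ring_scheme \<Rightarrow> ('r, 'a, 'n) module_scheme \<Rightarrow> 'a set \<Rightarrow> 'a set \<Rightarrow> 'a set \<Rightarrow>
     ('a \<Rightarrow> 'a \<Rightarrow> 'a) \<Rightarrow> bool" where
  "bilinear_on R A M N P f \<longleftrightarrow>
     (\<forall>x\<in>M. \<forall>y\<in>N. f x y \<in> P) \<and>
     (\<forall>x\<in>M. \<forall>x'\<in>M. \<forall>y\<in>N. f (x \<oplus>\<^bsub>A\<^esub> x') y = f x y \<oplus>\<^bsub>A\<^esub> f x' y) \<and>
     (\<forall>x\<in>M. \<forall>y\<in>N. \<forall>y'\<in>N. f x (y \<oplus>\<^bsub>A\<^esub> y') = f x y \<oplus>\<^bsub>A\<^esub> f x y') \<and>
     (\<forall>r\<in>carrier R. \<forall>x\<in>M. \<forall>y\<in>N. f (r \<odot>\<^bsub>A\<^esub> x) y = r \<odot>\<^bsub>A\<^esub> f x y) \<and>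
     (\<forall>r\<in>carrier R. \<forall>x\<in>M. \<forall>y\<in>N. f x (r \<odot>\<^bsub>A\<^esub> y) = r \<odot>\<^bsub>A\<^esub> f x y)"

text \<open>The algebra is not assumed commutative, so the library's locale \<open>algebra\<close> does not apply.
  The grading is internal: \<open>gr i\<close> is the homogeneous part of degree \<open>i\<close>.\<close>

locale graded_algebra = Module.module R A + ring A
  for R :: "('r, 'm) ring_scheme" and A :: "('r, 'a, 'n) module_scheme" +
  fixes gr :: "nat \<Rightarrow> 'a set"
  assumes smult_mult_left: "\<And>r a b. \<lbrakk>r \<in> carrier R; a \<in> carrier A; b \<in> carrier A\<rbrakk> \<Longrightarrow>
      r \<odot>\<^bsub>A\<^esub> (a \<otimes>\<^bsub>A\<^esub> b) = (r \<odot>\<^bsub>A\<^esub> a) \<otimes>\<^bsub>A\<^esub> b"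
    and smult_mult_right: "\<And>r a b. \<lbrakk>r \<in> carrier R; a \<in> carrier A; b \<in> carrier A\<rbrakk> \<Longrightarrow>
      r \<odot>\<^bsub>A\<^esub> (a \<otimes>\<^bsub>A\<^esub> b) = a \<otimes>\<^bsub>A\<^esub> (r \<odot>\<^bsub>A\<^esub> b)"
    and structure_map_inj: "inj_on (\<lambda>r. r \<odot>\<^bsub>A\<^esub> \<one>\<^bsub>A\<^esub>) (carrier R)"
    and gr_submodule: "\<And>i. Module.submodule (gr i) R A"
    and gr_direct_sum: "\<And>a. a \<in> carrier A \<Longrightarrow>
      \<exists>!f. (\<forall>i. f i \<in> gr i) \<and> finite {i. f i \<noteq> \<zero>\<^bsub>A\<^esub>} \<and>
           a = finsum A f {i. f i \<noteq> \<zero>\<^bsub>A\<^esub>}"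
    and gr_one: "\<one>\<^bsub>A\<^esub> \<in> gr 0"
    and gr_mult: "\<And>p q a b. \<lbrakk>a \<in> gr p; b \<in> gr q\<rbrakk> \<Longrightarrow> a \<otimes>\<^bsub>A\<^esub> b \<in> gr (p + q)"
begin

definition D2 :: "'a set" where
  "D2 = (\<lambda>N. Module.submodule N R A) hull {a \<otimes>\<^bsub>A\<^esub> b | a b. a \<in> gr 1 \<and> b \<in> gr 1}"

end

locale dg_algebra = graded_algebra R A gr
  for R :: "('r, 'm) ring_scheme" and A :: "('r, 'a, 'n) module_scheme" and gr +
  fixes d :: "'a \<Rightarrow> 'a"
  assumes d_closed: "\<And>a. a \<in> carrier A \<Longrightarrow> d a \<in> carrier A"
    and d_add: "\<And>a b. \<lbrakk>a \<in> carrier A; b \<in> carrier A\<rbrakk> \<Longrightarrow> d (a \<oplus>\<^bsub>A\<^esub> b) = d a \<oplus>\<^bsub>A\<^esub> d b"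
    and d_smult: "\<And>r a. \<lbrakk>r \<in> carrier R; a \<in> carrier A\<rbrakk> \<Longrightarrow> d (r \<odot>\<^bsub>A\<^esub> a) = r \<odot>\<^bsub>A\<^esub> d a"
    and d_degree: "\<And>p a. a \<in> gr p \<Longrightarrow> d a \<in> gr (p + 1)"
    and d_d: "\<And>a. a \<in> carrier A \<Longrightarrow> d (d a) = \<zero>\<^bsub>A\<^esub>"
    and Leibniz: "\<And>p q a b. \<lbrakk>a \<in> gr p; b \<in> gr q\<rbrakk> \<Longrightarrow>
      d (a \<otimes>\<^bsub>A\<^esub> b) =
        d a \<otimes>\<^bsub>A\<^esub> b \<oplus>\<^bsub>A\<^esub> ((\<ominus>\<^bsub>A\<^esub> \<one>\<^bsub>A\<^esub>) [^]\<^bsub>A\<^esub> p) \<otimes>\<^bsub>A\<^esub> (a \<otimes>\<^bsub>A\<^esub> d b)"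


section \<open>Cup-one products\<close>

definition unitization ::
    "('r, 'm) ring_scheme \<Rightarrow> ('r, 'a, 'n) module_scheme \<Rightarrow> 'a set \<Rightarrow> ('a \<Rightarrow> 'a \<Rightarrow> 'a) \<Rightarrow>
     ('r \<times> 'a) ring" where
  "unitization R A M m =
     \<lparr>carrier = carrier R \<times> M,
      monoid.mult = (\<lambda>(r, a) (s, b). (r \<otimes>\<^bsub>R\<^esub> s, r \<odot>\<^bsub>A\<^esub> b \<oplus>\<^bsub>A\<^esub> s \<odot>\<^bsub>A\<^esub> a \<oplus>\<^bsub>A\<^esub> m a b)),
      monoid.one = (\<one>\<^bsub>R\<^esub>, \<zero>\<^bsub>A\<^esub>),
      ring.zero = (\<zero>\<^bsub>R\<^esub>, \<zero>\<^bsub>A\<^esub>),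
      ring.add = (\<lambda>(r, a) (s, b). (r \<oplus>\<^bsub>R\<^esub> s, a \<oplus>\<^bsub>A\<^esub> b))\<rparr>"

text \<open>The two cup-one products, on degrees \<open>p = 1\<close> and \<open>p = 2\<close>, are given by one function.
  This is no restriction, since \<open>gr 1\<close> and \<open>gr 2\<close> meet only in zero.\<close>

locale cup_one_algebra = graded_algebra R A gr
  for R :: "('r, 'm) ring_scheme" and A :: "('r, 'a, 'n) module_scheme" and gr +
  fixes cup1 :: "'a \<Rightarrow> 'a \<Rightarrow> 'a"
  assumes cup1_bilinear: "\<And>p. p \<in> {1, 2} \<Longrightarrow> bilinear_on R A (gr p) (gr 1) (gr p) cup1"
    and Hirsch: "\<And>a b c. \<lbrakk>a \<in> gr 1; b \<in> gr 1; c \<in> gr 1\<rbrakk> \<Longrightarrow>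
      cup1 (a \<otimes>\<^bsub>A\<^esub> b) c = a \<otimes>\<^bsub>A\<^esub> cup1 b c \<oplus>\<^bsub>A\<^esub> cup1 a c \<otimes>\<^bsub>A\<^esub> b"
    and unitization_cring: "cring (unitization R A (gr 1) cup1)"

locale cup_one_dga = dg_algebra R A gr d + cup_one_algebra R A gr cup1
  for R :: "('r, 'm) ring_scheme" and A :: "('r, 'a, 'n) module_scheme" and gr d cup1 +
  fixes circ :: "'a \<Rightarrow> 'a \<Rightarrow> 'a"
  assumes circ_bilinear: "bilinear_on R A D2 D2 D2 circ"
    and circ_cup: "\<And>u v w z. \<lbrakk>u \<in> gr 1; v \<in> gr 1; w \<in> gr 1; z \<in> gr 1\<rbrakk> \<Longrightarrow>
      circ (u \<otimes>\<^bsub>A\<^esub> v) (w \<otimes>\<^bsub>A\<^esub> z) = cup1 u w \<otimes>\<^bsub>A\<^esub> cup1 v z"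
    and d_cup1: "\<And>a b. \<lbrakk>a \<in> gr 1; b \<in> gr 1; d a \<in> D2; d b \<in> D2\<rbrakk> \<Longrightarrow>
      d (cup1 a b) =
        (\<ominus>\<^bsub>A\<^esub> (a \<otimes>\<^bsub>A\<^esub> b)) \<ominus>\<^bsub>A\<^esub> b \<otimes>\<^bsub>A\<^esub> a \<oplus>\<^bsub>A\<^esub> cup1 (d a) b \<oplus>\<^bsub>A\<^esub> cup1 (d b) a
          \<ominus>\<^bsub>A\<^esub> circ (d a) (d b)"

locale binomial_cup_one_dga = cup_one_dga R A gr d cup1 circ
  for R :: "('r, 'm) ring_scheme" and A :: "('r, 'a, 'n) module_scheme" and gr d cup1 circ +
  assumes base_binomial: "binomial_ring R"
    and unitization_binomial: "binomial_ring (unitization R A (gr 1) cup1)"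


section \<open>Tensor algebras\<close>

text \<open>The free ring on a set \<open>S\<close>: integer linear combinations of words over \<open>S\<close>, multiplied by
  concatenation.\<close>

definition word_mult :: "('a list \<Rightarrow>\<^sub>0 int) \<Rightarrow> ('a list \<Rightarrow>\<^sub>0 int) \<Rightarrow> ('a list \<Rightarrow>\<^sub>0 int)" where
  "word_mult f g = frag_extend (\<lambda>u. frag_extend (\<lambda>v. frag_of (u @ v)) g) f"

definition free_ring :: "'a set \<Rightarrow> ('a list \<Rightarrow>\<^sub>0 int) ring" where
  "free_ring S =
     \<lparr>carrier = {c. Poly_Mapping.keys c \<subseteq> lists S},
      monoid.mult = word_mult, monoid.one = frag_of [], ring.zero = 0, ring.add = (+)\<rparr>"

text \<open>The tensor algebra, over the integers, of an abelian group \<open>G\<close> (written multiplicatively):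
  the class of the word \<open>[a\<^sub>1, \<dots>, a\<^sub>n]\<close> is \<open>a\<^sub>1 \<otimes> \<dots> \<otimes> a\<^sub>n\<close>. The relations, taken in word length
  one, generate as a two-sided ideal all the multilinearity relations.\<close>

definition tensor_ideal :: "('a, 'm) monoid_scheme \<Rightarrow> ('a list \<Rightarrow>\<^sub>0 int) set" where
  "tensor_ideal G =
     Idl\<^bsub>free_ring (carrier G)\<^esub>
       {frag_of [a \<otimes>\<^bsub>G\<^esub> b] - frag_of [a] - frag_of [b] | a b. a \<in> carrier G \<and> b \<in> carrier G}"

definition tensor_class ::
    "('a, 'm) monoid_scheme \<Rightarrow> ('a list \<Rightarrow>\<^sub>0 int) \<Rightarrow> ('a list \<Rightarrow>\<^sub>0 int) set" where
  "tensor_class G c = tensor_ideal G +>\<^bsub>free_ring (carrier G)\<^esub> c"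

definition tensor_algebra ::
    "('a, 'm) monoid_scheme \<Rightarrow> (int, ('a list \<Rightarrow>\<^sub>0 int) set) module" where
  "tensor_algebra G =
     (let Q = free_ring (carrier G) Quot tensor_ideal G in
      \<lparr>carrier = carrier Q, monoid.mult = monoid.mult Q, monoid.one = monoid.one Q,
       ring.zero = ring.zero Q, ring.add = ring.add Q,
       smult = (\<lambda>k U. [k] \<cdot>\<^bsub>Q\<^esub> U)\<rparr>)"

definition tensor_grade ::
    "('a, 'm) monoid_scheme \<Rightarrow> nat \<Rightarrow> ('a list \<Rightarrow>\<^sub>0 int) set set" where
  "tensor_grade G n =
     tensor_class G ` {c. Poly_Mapping.keys c \<subseteq> {w \<in> lists (carrier G). length w = n}}"

text \<open>A binary operation on words, extended bilinearly and passed to classes. In the style of the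
  library's multiplication of cosets, the result is the union of the classes obtained from all
  representatives, which is a single class if the operation respects the multilinearity
  relations.\<close>

definition tensor_lift ::
    "('a, 'm) monoid_scheme \<Rightarrow> ('a list \<Rightarrow> 'a list \<Rightarrow> ('a list \<Rightarrow>\<^sub>0 int)) \<Rightarrow>
     ('a list \<Rightarrow>\<^sub>0 int) set \<Rightarrow> ('a list \<Rightarrow>\<^sub>0 int) set \<Rightarrow> ('a list \<Rightarrow>\<^sub>0 int) set" where
  "tensor_lift G h U V =
     (\<Union>f\<in>U. \<Union>g\<in>V. tensor_class G (frag_extend (\<lambda>u. frag_extend (h u) g) f))"


section \<open>The free binomial graded algebra\<close>

text \<open>The variables are the elements of \<open>X :: 'x set\<close>, which may be empty. Monomials are finitely
  supported exponent functions.\<close>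

type_synonym 'x qpoly = "('x \<Rightarrow>\<^sub>0 nat) \<Rightarrow>\<^sub>0 rat"

definition qpoly_vars :: "'x qpoly \<Rightarrow> 'x set" where
  "qpoly_vars q = (\<Union>m\<in>Poly_Mapping.keys q. Poly_Mapping.keys m)"

definition qpoly_eval :: "('x \<Rightarrow> int) \<Rightarrow> 'x qpoly \<Rightarrow> rat" where
  "qpoly_eval v q =
     (\<Sum>m\<in>Poly_Mapping.keys q. Poly_Mapping.lookup q m *
        (\<Prod>x\<in>Poly_Mapping.keys m. of_int (v x) ^ Poly_Mapping.lookup m x))"

definition Var :: "'x \<Rightarrow> 'x qpoly" where
  "Var x = Poly_Mapping.single (Poly_Mapping.single x 1) 1"

text \<open>Values of \<open>v\<close> outside \<open>X\<close> do not affect the evaluation of a polynomial in the variables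
  \<open>X\<close>, so \<open>v\<close> ranges over total functions.\<close>

definition Int_poly :: "'x set \<Rightarrow> 'x qpoly set" where
  "Int_poly X = {q. qpoly_vars q \<subseteq> X \<and> (\<forall>v. qpoly_eval v q \<in> \<int>)}"

definition m_ideal :: "'x set \<Rightarrow> 'x qpoly set" where
  "m_ideal X = {q \<in> Int_poly X. Poly_Mapping.lookup q 0 = 0}"

definition m_group :: "'x set \<Rightarrow> 'x qpoly monoid" where
  "m_group X = \<lparr>carrier = m_ideal X, monoid.mult = (+), monoid.one = 0\<rparr>"

type_synonym 'x free_binomial = "('x qpoly list \<Rightarrow>\<^sub>0 int) set"

definition T_alg :: "'x set \<Rightarrow> (int, 'x free_binomial) module" where
  "T_alg X = tensor_algebra (m_group X)"

definition T_grade :: "'x set \<Rightarrow> nat \<Rightarrow> 'x free_binomial set" where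
  "T_grade X = tensor_grade (m_group X)"

definition T_incl :: "'x set \<Rightarrow> 'x qpoly \<Rightarrow> 'x free_binomial" where
  "T_incl X q = tensor_class (m_group X) (frag_of [q])"

text \<open>These are zero outside the degrees where the products are defined.\<close>

fun cup1_words :: "'x qpoly list \<Rightarrow> 'x qpoly list \<Rightarrow> ('x qpoly list \<Rightarrow>\<^sub>0 int)" where
  "cup1_words [a] [c] = frag_of [a * c]"
| "cup1_words [a, b] [c] = frag_of [a * c, b] + frag_of [a, b * c]"
| "cup1_words _ _ = 0"

fun circ_words :: "'x qpoly list \<Rightarrow> 'x qpoly list \<Rightarrow> ('x qpoly list \<Rightarrow>\<^sub>0 int)" where
  "circ_words [a\<^sub>1, a\<^sub>2] [b\<^sub>1, b\<^sub>2] = frag_of [a\<^sub>1 * b\<^sub>1, a\<^sub>2 * b\<^sub>2]"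
| "circ_words _ _ = 0"

definition T_cup1 :: "'x set \<Rightarrow> 'x free_binomial \<Rightarrow> 'x free_binomial \<Rightarrow> 'x free_binomial" where
  "T_cup1 X = tensor_lift (m_group X) cup1_words"

definition T_circ :: "'x set \<Rightarrow> 'x free_binomial \<Rightarrow> 'x free_binomial \<Rightarrow> 'x free_binomial" where
  "T_circ X = tensor_lift (m_group X) circ_words"

end

theory Submission
  imports Defs "HOL-Computational_Algebra.Formal_Power_Series"
begin

text \<open>
  Polynomials act as functions on the points \<open>v :: 'x \<Rightarrow> int\<close>, and a tensor \<open>a\<^sub>1 \<otimes> \<dots> \<otimes> a\<^sub>n\<close> acts as the
  function \<open>(v\<^sub>1, \<dots>, v\<^sub>n) \<mapsto> a\<^sub>1(v\<^sub>1) \<cdots> a\<^sub>n(v\<^sub>n)\<close> of \<open>n\<close> points, an inhomogeneous cochain of the additive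
  group of points. The differential is the coboundary of group cohomology, which in degree one is
  \<open>(d p)(v, w) = p(v) + p(w) - p(v + w)\<close>. It vanishes on the variables, since these are additive,
  and it is a derivation of square zero (\<open>coboundary_cup\<close>, \<open>coboundary_coboundary\<close>). Moreover
  \<open>p \<mapsto> p(v + w)\<close> is multiplicative; inserting \<open>p(v + w) = p(v) + p(w) - (d p)(v, w)\<close> for \<open>p = a\<close>,
  \<open>p = b\<close> and \<open>p = a b\<close> gives precisely the required formula for \<open>d (a \<union>\<^sub>1 b)\<close>.

  Two facts make this an argument about the tensor algebra itself. Firstly, a tensor is determined by
  its cochain (\<open>tensor_ideal_iff\<close>, \<open>T_cochain_inject\<close>), so that all axioms can be checked on functions.
  Secondly, the coboundary of the cochain of a tensor is again the cochain of a tensor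
  (\<open>coboundary_cochain\<close>). Both rest on the basis of the integer-valued polynomials given by the products
  of binomial coefficients of the variables (\<open>Int_poly_binom_basis\<close>): evaluation at the points with
  natural coordinates is unitriangular on this basis, hence on words of basis elements, which gives the
  first fact; and Vandermonde's identity splits \<open>p(v + w)\<close> into a sum of products \<open>q(v) r(w)\<close> of
  integer-valued polynomials (\<open>separable_translate\<close>), which gives the second.

  Finally, the unitization of the degree one part is the ring of integer-valued polynomials, which is
  closed under binomial coefficients because the integers are (\<open>T_unit_binomial\<close>).
\<close>

section \<open>Evaluation of polynomials\<close>

lemma poly_mapping_sum_singles:
  "p = (\<Sum>m\<in>Poly_Mapping.keys p. Poly_Mapping.single m (Poly_Mapping.lookup p m))"
proof (rule poly_mapping_eqI)
  fix k
  have "Poly_Mapping.lookup (\<Sum>m\<in>Poly_Mapping.keys p. Poly_Mapping.single m (Poly_Mapping.lookup p m)) k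
      = (\<Sum>m\<in>Poly_Mapping.keys p. if m = k then Poly_Mapping.lookup p m else 0)"
    by (simp add: lookup_sum lookup_single when_def)
  also have "\<dots> = Poly_Mapping.lookup p k"
    by (simp add: sum.delta not_in_keys_iff_lookup_eq_zero)
  finally show "Poly_Mapping.lookup p k =
      Poly_Mapping.lookup (\<Sum>m\<in>Poly_Mapping.keys p. Poly_Mapping.single m (Poly_Mapping.lookup p m)) k"
    by simp
qed

text \<open>The value of the monomial with exponents \<open>m\<close> at the point \<open>v\<close>.\<close>

definition monomial_eval :: "('x \<Rightarrow> int) \<Rightarrow> ('x \<Rightarrow>\<^sub>0 nat) \<Rightarrow> rat" where
  "monomial_eval v m = (\<Prod>x\<in>Poly_Mapping.keys m. of_int (v x) ^ Poly_Mapping.lookup m x)"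

lemma monomial_eval_superset:
  assumes "finite A" "Poly_Mapping.keys m \<subseteq> A"
  shows "monomial_eval v m = (\<Prod>x\<in>A. of_int (v x) ^ Poly_Mapping.lookup m x)"
  unfolding monomial_eval_def
  by (rule prod.mono_neutral_left) (use assms in \<open>auto simp: in_keys_iff\<close>)

lemma monomial_eval_0 [simp]: "monomial_eval v 0 = 1"
  by (simp add: monomial_eval_def)

lemma monomial_eval_add: "monomial_eval v (m + n) = monomial_eval v m * monomial_eval v n"
proof -
  let ?A = "Poly_Mapping.keys m \<union> Poly_Mapping.keys n"
  have "Poly_Mapping.keys (m + n) \<subseteq> ?A"
    by (rule keys_add)
  then show ?thesis
    by (simp add: monomial_eval_superset[of ?A] lookup_add power_add prod.distrib)
qed

lemma qpoly_eval_superset: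
  assumes "finite A" "Poly_Mapping.keys q \<subseteq> A"
  shows "qpoly_eval v q = (\<Sum>m\<in>A. Poly_Mapping.lookup q m * monomial_eval v m)"
  unfolding qpoly_eval_def monomial_eval_def[symmetric]
  by (rule sum.mono_neutral_left) (use assms in \<open>auto simp: in_keys_iff\<close>)

lemma qpoly_eval_0 [simp]: "qpoly_eval v 0 = 0"
  by (simp add: qpoly_eval_def)

lemma qpoly_eval_add: "qpoly_eval v (p + q) = qpoly_eval v p + qpoly_eval v q"
proof -
  let ?A = "Poly_Mapping.keys p \<union> Poly_Mapping.keys q"
  have "Poly_Mapping.keys (p + q) \<subseteq> ?A"
    by (rule keys_add)
  then show ?thesis
    by (simp add: qpoly_eval_superset[of ?A] lookup_add sum.distrib distrib_right)
qed

lemma qpoly_eval_uminus: "qpoly_eval v (- p) = - qpoly_eval v p"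
  using qpoly_eval_add[of v p "- p"] by simp

lemma qpoly_eval_diff: "qpoly_eval v (p - q) = qpoly_eval v p - qpoly_eval v q"
  using qpoly_eval_add[of v p "- q"] by (simp add: qpoly_eval_uminus)

lemma qpoly_eval_sum: "qpoly_eval v (sum f A) = (\<Sum>a\<in>A. qpoly_eval v (f a))"
  by (induction A rule: infinite_finite_induct) (auto simp: qpoly_eval_add)

lemma qpoly_eval_single: "qpoly_eval v (Poly_Mapping.single m c) = c * monomial_eval v m"
  by (simp add: qpoly_eval_superset[of "{m}"])

lemma qpoly_eval_mult: "qpoly_eval v (p * q) = qpoly_eval v p * qpoly_eval v q"
proof -
  let ?s = "\<lambda>p m. Poly_Mapping.single m (Poly_Mapping.lookup p m)"
  have "p * q = (\<Sum>m\<in>Poly_Mapping.keys p. ?s p m) * (\<Sum>n\<in>Poly_Mapping.keys q. ?s q n)"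
    by (simp flip: poly_mapping_sum_singles)
  also have "qpoly_eval v \<dots> = (\<Sum>m\<in>Poly_Mapping.keys p. \<Sum>n\<in>Poly_Mapping.keys q.
      qpoly_eval v (?s p m) * qpoly_eval v (?s q n))"
    by (simp add: sum_product qpoly_eval_sum mult_single qpoly_eval_single monomial_eval_add
        algebra_simps)
  also have "\<dots> = qpoly_eval v (\<Sum>m\<in>Poly_Mapping.keys p. ?s p m) *
      qpoly_eval v (\<Sum>n\<in>Poly_Mapping.keys q. ?s q n)"
    by (simp add: sum_product qpoly_eval_sum)
  finally show ?thesis
    by (simp flip: poly_mapping_sum_singles)
qed

lemma qpoly_eval_const: "qpoly_eval v (Poly_Mapping.single 0 c) = c"
  by (simp add: qpoly_eval_single)

lemma qpoly_eval_1 [simp]: "qpoly_eval v 1 = 1"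
  using qpoly_eval_const[of v 1] by simp

lemma qpoly_eval_of_int [simp]: "qpoly_eval v (of_int k) = of_int k"
  by (metis qpoly_eval_const single_of_int)

lemma qpoly_eval_of_nat [simp]: "qpoly_eval v (of_nat k) = of_nat k"
  by (metis qpoly_eval_const single_of_nat)

lemma qpoly_eval_prod: "qpoly_eval v (prod f A) = (\<Prod>a\<in>A. qpoly_eval v (f a))"
  by (induction A rule: infinite_finite_induct) (auto simp: qpoly_eval_mult)

lemma qpoly_eval_Var [simp]: "qpoly_eval v (Var x) = of_int (v x)"
  by (simp add: Var_def qpoly_eval_single monomial_eval_def)

lemma qpoly_eval_zero: "qpoly_eval (\<lambda>_. 0) q = Poly_Mapping.lookup q 0"
proof -
  have "monomial_eval (\<lambda>_. 0) m = (if m = 0 then 1 else 0)" for m :: "'a \<Rightarrow>\<^sub>0 nat"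
  proof (cases "m = 0")
    case False
    then obtain x where "x \<in> Poly_Mapping.keys m"
      by (metis all_not_in_conv keys_eq_empty)
    then show ?thesis
      using False by (auto simp: monomial_eval_def prod_zero_iff in_keys_iff)
  qed simp
  then have "qpoly_eval (\<lambda>_. 0) q =
      (\<Sum>m\<in>Poly_Mapping.keys q. if m = 0 then Poly_Mapping.lookup q m else 0)"
    by (simp only: qpoly_eval_superset[OF finite_keys order_refl]) (intro sum.cong, auto)
  then show ?thesis
    by (simp add: sum.delta not_in_keys_iff_lookup_eq_zero)
qed

section \<open>Integer-valued polynomials\<close>

lemma qpoly_vars_add: "qpoly_vars (p + q) \<subseteq> qpoly_vars p \<union> qpoly_vars q"
  using keys_add[of p q] by (auto simp: qpoly_vars_def)

lemma qpoly_vars_uminus [simp]: "qpoly_vars (- p) = qpoly_vars p"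
  by (simp add: qpoly_vars_def in_keys_iff Poly_Mapping.keys.rep_eq)

lemma qpoly_vars_mult: "qpoly_vars (p * q) \<subseteq> qpoly_vars p \<union> qpoly_vars q"
proof
  fix x assume "x \<in> qpoly_vars (p * q)"
  then obtain m n where "m \<in> Poly_Mapping.keys p" "n \<in> Poly_Mapping.keys q"
      "x \<in> Poly_Mapping.keys (m + n)"
    using keys_mult[of p q] by (force simp: qpoly_vars_def)
  then show "x \<in> qpoly_vars p \<union> qpoly_vars q"
    using keys_add[of m n] by (auto simp: qpoly_vars_def)
qed

lemma qpoly_vars_const [simp]: "qpoly_vars (Poly_Mapping.single 0 c) = {}"
  by (simp add: qpoly_vars_def)

lemma qpoly_vars_of_int [simp]: "qpoly_vars (of_int k) = {}"
  by (metis qpoly_vars_const single_of_int)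

lemma qpoly_vars_of_nat [simp]: "qpoly_vars (of_nat k) = {}"
  by (metis qpoly_vars_const single_of_nat)

lemma qpoly_vars_Var [simp]: "qpoly_vars (Var x) = {x}"
  by (simp add: qpoly_vars_def Var_def)

lemma Int_poly_add: "p \<in> Int_poly X \<Longrightarrow> q \<in> Int_poly X \<Longrightarrow> p + q \<in> Int_poly X"
  using qpoly_vars_add[of p q] by (auto simp: Int_poly_def qpoly_eval_add)

lemma Int_poly_uminus: "p \<in> Int_poly X \<Longrightarrow> - p \<in> Int_poly X"
  by (auto simp: Int_poly_def qpoly_eval_uminus)

lemma Int_poly_diff: "p \<in> Int_poly X \<Longrightarrow> q \<in> Int_poly X \<Longrightarrow> p - q \<in> Int_poly X"
  using Int_poly_add[of p X "- q"] Int_poly_uminus[of q X] by simp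

lemma Int_poly_mult: "p \<in> Int_poly X \<Longrightarrow> q \<in> Int_poly X \<Longrightarrow> p * q \<in> Int_poly X"
  using qpoly_vars_mult[of p q] by (auto simp: Int_poly_def qpoly_eval_mult)

lemma Int_poly_of_int: "of_int k \<in> Int_poly X"
  by (simp add: Int_poly_def)

lemma Int_poly_0: "0 \<in> Int_poly X"
  using Int_poly_of_int[of 0 X] by simp

lemma Int_poly_1: "1 \<in> Int_poly X"
  using Int_poly_of_int[of 1 X] by simp

lemma Int_poly_of_nat: "of_nat k \<in> Int_poly X"
  by (simp add: Int_poly_def)

lemma Int_poly_Var: "x \<in> X \<Longrightarrow> Var x \<in> Int_poly X"
  by (simp add: Int_poly_def)

lemma Int_poly_prod: "(\<And>a. a \<in> A \<Longrightarrow> f a \<in> Int_poly X) \<Longrightarrow> prod f A \<in> Int_poly X"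
  by (induction A rule: infinite_finite_induct) (auto simp: Int_poly_1 Int_poly_mult)

text \<open>The binomial coefficient of \<open>p\<close> over \<open>k\<close>, that is \<open>p (p - 1) \<dots> (p - k + 1) / k!\<close>.\<close>

definition binom_poly :: "'x qpoly \<Rightarrow> nat \<Rightarrow> 'x qpoly" where
  "binom_poly p k = Poly_Mapping.single 0 (1 / fact k) * (\<Prod>i<k. p - of_nat i)"

lemma binom_poly_0 [simp]: "binom_poly p 0 = 1"
  by (simp add: binom_poly_def)

lemma binom_poly_eval: "qpoly_eval v (binom_poly p k) = qpoly_eval v p gchoose k"
  by (simp add: binom_poly_def qpoly_eval_mult qpoly_eval_prod qpoly_eval_diff qpoly_eval_const
      gbinomial_prod_rev atLeast0LessThan)

lemma gbinomial_of_int_Ints: "(of_int a :: rat) gchoose k \<in> \<int>"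
proof (cases "a \<ge> 0")
  case True
  then have "(of_int a :: rat) gchoose k = of_nat (nat a choose k)"
    by (simp add: binomial_gbinomial)
  then show ?thesis by simp
next
  case False
  have "(of_int a :: rat) gchoose k = (-1) ^ k * ((of_nat k - of_int a - 1) gchoose k)"
    by (rule gbinomial_negated_upper)
  also have "of_nat k - of_int a - 1 = (of_nat (nat (int k - a - 1)) :: rat)"
    using False by simp
  also have "(-1) ^ k * (\<dots> gchoose k) = (-1) ^ k * of_nat (nat (int k - a - 1) choose k)"
    by (simp only: binomial_gbinomial)
  finally show ?thesis by simp
qed

lemma Int_poly_binom_poly:
  assumes "p \<in> Int_poly X"
  shows "binom_poly p k \<in> Int_poly X"
proof -
  have vars: "qpoly_vars (\<Prod>i<k. p - of_nat i) \<subseteq> X"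
  proof -
    have "(\<Prod>i<k. p - of_nat i) \<in> Int_poly X"
      by (intro Int_poly_prod Int_poly_diff Int_poly_of_nat assms)
    then show ?thesis
      by (simp add: Int_poly_def)
  qed
  have "qpoly_vars (binom_poly p k) \<subseteq> X"
    using qpoly_vars_mult[of "Poly_Mapping.single 0 (1 / fact k)" "\<Prod>i<k. p - of_nat i"] vars
    by (auto simp: binom_poly_def)
  moreover have "qpoly_eval v (binom_poly p k) \<in> \<int>" for v
    using assms by (auto simp: binom_poly_eval Int_poly_def gbinomial_of_int_Ints elim!: Ints_cases[of "qpoly_eval v p"] dest: spec[of _ v])
  ultimately show ?thesis
    by (simp add: Int_poly_def)
qed

lemma binom_poly_Suc:
  "p * binom_poly p k = of_nat (Suc k) * binom_poly p (Suc k) + of_nat k * binom_poly p k"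
proof -
  have "of_nat (Suc k) * Poly_Mapping.single 0 (1 / fact (Suc k)) =
      (Poly_Mapping.single 0 (1 / fact k) :: 'a qpoly)"
    by (simp add: of_nat_single mult_single del: of_nat_Suc flip: single_of_nat)
  then have "of_nat (Suc k) * binom_poly p (Suc k) = binom_poly p k * (p - of_nat k)"
    unfolding binom_poly_def by (simp only: prod.lessThan_Suc mult.assoc[symmetric])
  then show ?thesis
    by (simp only: right_diff_distrib mult.commute diff_add_cancel)
qed

section \<open>The binomial basis\<close>

text \<open>The product of the binomial coefficients of the variables, with the lower indices given by a
  multi-index. The products for the multi-indices supported in \<open>X\<close> form a basis of the group of
  integer-valued polynomials in the variables \<open>X\<close>.\<close>

definition binom_monomial :: "('x \<Rightarrow>\<^sub>0 nat) \<Rightarrow> 'x qpoly" where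
  "binom_monomial I = (\<Prod>x\<in>Poly_Mapping.keys I. binom_poly (Var x) (Poly_Mapping.lookup I x))"

lemma binom_monomial_superset:
  assumes "finite A" "Poly_Mapping.keys I \<subseteq> A"
  shows "binom_monomial I = (\<Prod>x\<in>A. binom_poly (Var x) (Poly_Mapping.lookup I x))"
  unfolding binom_monomial_def
  by (rule prod.mono_neutral_left) (use assms in \<open>auto simp: in_keys_iff\<close>)

lemma binom_monomial_0 [simp]: "binom_monomial 0 = 1"
  by (simp add: binom_monomial_def)

lemma Int_poly_binom_monomial:
  "Poly_Mapping.keys I \<subseteq> X \<Longrightarrow> binom_monomial I \<in> Int_poly X"
  unfolding binom_monomial_def
  by (intro Int_poly_prod Int_poly_binom_poly Int_poly_Var) auto

lemma Var_mult_binom_monomial: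
  "Var x * binom_monomial I =
     of_nat (Suc (Poly_Mapping.lookup I x)) * binom_monomial (I + Poly_Mapping.single x 1) +
     of_nat (Poly_Mapping.lookup I x) * binom_monomial I"
proof -
  define A where "A = Poly_Mapping.keys I - {x}"
  define k where "k = Poly_Mapping.lookup I x"
  define r where "r = (\<Prod>y\<in>A. binom_poly (Var y) (Poly_Mapping.lookup I y))"
  have A: "finite (insert x A)" "x \<notin> A"
    by (auto simp: A_def)
  have 1: "binom_monomial I = binom_poly (Var x) k * r"
    using A by (subst binom_monomial_superset[of "insert x A"]) (simp_all add: k_def r_def, auto simp: A_def)
  have "binom_monomial (I + Poly_Mapping.single x 1) = binom_poly (Var x) (Suc k) *
      (\<Prod>y\<in>A. binom_poly (Var y) (Poly_Mapping.lookup (I + Poly_Mapping.single x 1) y))"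
  proof -
    have "Poly_Mapping.keys (I + Poly_Mapping.single x 1) \<subseteq> insert x A"
      using keys_add[of I "Poly_Mapping.single x 1"] by (auto simp: A_def split: if_splits)
    then show ?thesis
      using A by (simp add: binom_monomial_superset[of "insert x A"] k_def lookup_add)
  qed
  also have "(\<Prod>y\<in>A. binom_poly (Var y) (Poly_Mapping.lookup (I + Poly_Mapping.single x 1) y)) = r"
    unfolding r_def using A by (intro prod.cong) (auto simp: lookup_add lookup_single when_def)
  finally have 2: "binom_monomial (I + Poly_Mapping.single x 1) = binom_poly (Var x) (Suc k) * r" .
  have "Var x * binom_monomial I = (Var x * binom_poly (Var x) k) * r"
    by (simp add: 1 mult.assoc)
  also have "\<dots> = of_nat (Suc k) * (binom_poly (Var x) (Suc k) * r) +
      of_nat k * (binom_poly (Var x) k * r)"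
    by (simp only: binom_poly_Suc distrib_right mult.assoc)
  finally show ?thesis
    by (simp only: 1 2 k_def)
qed

text \<open>The rational combinations of the products of binomial coefficients. They are closed under
  multiplication by the variables in \<open>X\<close>, hence are all polynomials in these variables.\<close>

definition binom_span :: "'x set \<Rightarrow> 'x qpoly set" where
  "binom_span X = {\<Sum>I\<in>A. Poly_Mapping.single 0 (c I) * binom_monomial I | A c.
     finite A \<and> (\<forall>I\<in>A. Poly_Mapping.keys I \<subseteq> X)}"

lemma binom_span_single:
  "Poly_Mapping.keys I \<subseteq> X \<Longrightarrow> Poly_Mapping.single 0 c * binom_monomial I \<in> binom_span X"
  unfolding binom_span_def by (intro CollectI exI[of _ "{I}"] exI[of _ "\<lambda>_. c"]) simp

lemma binom_span_0: "0 \<in> binom_span X"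
  unfolding binom_span_def by (intro CollectI exI[of _ "{}"]) simp

lemma binom_span_add:
  assumes "p \<in> binom_span X" "q \<in> binom_span X"
  shows "p + q \<in> binom_span X"
proof -
  obtain A a where A: "finite A" "\<forall>I\<in>A. Poly_Mapping.keys I \<subseteq> X"
      "p = (\<Sum>I\<in>A. Poly_Mapping.single 0 (a I) * binom_monomial I)"
    using assms(1) by (auto simp: binom_span_def)
  obtain B b where B: "finite B" "\<forall>I\<in>B. Poly_Mapping.keys I \<subseteq> X"
      "q = (\<Sum>I\<in>B. Poly_Mapping.single 0 (b I) * binom_monomial I)"
    using assms(2) by (auto simp: binom_span_def)
  let ?a = "\<lambda>I. if I \<in> A then a I else 0" and ?b = "\<lambda>I. if I \<in> B then b I else 0"
  have "p = (\<Sum>I\<in>A \<union> B. Poly_Mapping.single 0 (?a I) * binom_monomial I)"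
    unfolding A(3) by (rule sum.mono_neutral_cong_left) (use A B in auto)
  moreover have "q = (\<Sum>I\<in>A \<union> B. Poly_Mapping.single 0 (?b I) * binom_monomial I)"
    unfolding B(3) by (rule sum.mono_neutral_cong_left) (use A B in auto)
  ultimately have "p + q = (\<Sum>I\<in>A \<union> B. Poly_Mapping.single 0 (?a I + ?b I) * binom_monomial I)"
    by (simp only: single_add distrib_right sum.distrib)
  then show ?thesis
    unfolding binom_span_def using A B
    by (intro CollectI exI[of _ "A \<union> B"] exI[of _ "\<lambda>I. ?a I + ?b I"]) auto
qed

lemma binom_span_sum: "(\<And>a. a \<in> A \<Longrightarrow> f a \<in> binom_span X) \<Longrightarrow> sum f A \<in> binom_span X"
  by (induction A rule: infinite_finite_induct) (auto simp: binom_span_0 binom_span_add)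

lemma binom_span_Var_mult:
  assumes "p \<in> binom_span X" "x \<in> X"
  shows "Var x * p \<in> binom_span X"
proof -
  obtain A c where A: "finite A" "\<forall>I\<in>A. Poly_Mapping.keys I \<subseteq> X"
      "p = (\<Sum>I\<in>A. Poly_Mapping.single 0 (c I) * binom_monomial I)"
    using assms(1) by (auto simp: binom_span_def)
  have "Var x * p = (\<Sum>I\<in>A. Poly_Mapping.single 0 (c I) * (Var x * binom_monomial I))"
    unfolding A(3) by (simp add: sum_distrib_left mult_ac)
  also have "\<dots> = (\<Sum>I\<in>A.
      Poly_Mapping.single 0 (c I * of_nat (Suc (Poly_Mapping.lookup I x))) *
        binom_monomial (I + Poly_Mapping.single x 1) +
      Poly_Mapping.single 0 (c I * of_nat (Poly_Mapping.lookup I x)) * binom_monomial I)"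
    by (intro sum.cong refl)
      (simp only: Var_mult_binom_monomial distrib_left mult.assoc[symmetric] mult_single
        single_of_nat[symmetric] add_0)
  also have "\<dots> \<in> binom_span X"
    using A assms(2) keys_add[of _ "Poly_Mapping.single x (1::nat)"]
    by (intro binom_span_sum binom_span_add binom_span_single) fastforce+
  finally show ?thesis .
qed

lemma Var_power: "Var x ^ n = Poly_Mapping.single (Poly_Mapping.single x n) 1"
proof (induction n)
  case (Suc n)
  then show ?case
    by (simp add: Var_def mult_single flip: single_add)
qed simp

lemma binom_span_monomial_mult:
  "Poly_Mapping.keys m \<subseteq> X \<Longrightarrow> p \<in> binom_span X \<Longrightarrow> Poly_Mapping.single m 1 * p \<in> binom_span X"
proof (induction m arbitrary: p rule: update_induct)
  case const
  then show ?case by simp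
next
  case (update m x n)
  have m: "Poly_Mapping.update x n m = m + Poly_Mapping.single x n"
    using update.hyps
    by (intro poly_mapping_eqI) (auto simp: lookup_update lookup_add lookup_single when_def in_keys_iff)
  have X: "Poly_Mapping.keys m \<subseteq> X" "x \<in> X"
    using update.prems(1) update.hyps by (auto simp: keys_update split: if_splits)
  have "Var x ^ j * p \<in> binom_span X" for j
    by (induction j) (auto simp: update.prems mult.assoc intro: binom_span_Var_mult X(2))
  then have "Poly_Mapping.single m 1 * (Var x ^ n * p) \<in> binom_span X"
    using X(1) by (intro update.IH)
  then show ?case
    by (simp add: m Var_power mult_single flip: mult.assoc)
qed

lemma binom_span_all:
  assumes "qpoly_vars p \<subseteq> X"
  shows "p \<in> binom_span X"
proof -
  have "Poly_Mapping.single m (Poly_Mapping.lookup p m) \<in> binom_span X"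
    if "m \<in> Poly_Mapping.keys p" for m
  proof -
    have "Poly_Mapping.single m 1 * (Poly_Mapping.single 0 (Poly_Mapping.lookup p m) * binom_monomial 0)
        \<in> binom_span X"
      using that assms
      by (intro binom_span_monomial_mult binom_span_single) (auto simp: qpoly_vars_def)
    then show ?thesis
      by (simp add: mult_single)
  qed
  then show ?thesis
    by (subst poly_mapping_sum_singles) (rule binom_span_sum)
qed

text \<open>A multi-index is also a point with natural coordinates. The value of the \<open>J\<close>-th basis element
  at the point \<open>I\<close> is zero unless \<open>J \<le> I\<close> coordinatewise, and it is one for \<open>J = I\<close>; so evaluation at
  these points is triangular with respect to the total degree.\<close>

definition multi_degree :: "('x \<Rightarrow>\<^sub>0 nat) \<Rightarrow> nat" where
  "multi_degree I = (\<Sum>x\<in>Poly_Mapping.keys I. Poly_Mapping.lookup I x)"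

definition lattice_point :: "('x \<Rightarrow>\<^sub>0 nat) \<Rightarrow> 'x \<Rightarrow> int" where
  "lattice_point I x = int (Poly_Mapping.lookup I x)"

lemma lattice_point_0: "lattice_point 0 = (\<lambda>_. 0)"
  by (simp add: lattice_point_def fun_eq_iff)

lemma binom_monomial_lattice_point:
  "qpoly_eval (lattice_point I) (binom_monomial J) =
     (\<Prod>x\<in>Poly_Mapping.keys J. of_nat (Poly_Mapping.lookup I x choose Poly_Mapping.lookup J x))"
  by (simp add: binom_monomial_def qpoly_eval_prod binom_poly_eval lattice_point_def
      binomial_gbinomial)

lemma binom_monomial_lattice_point_same: "qpoly_eval (lattice_point I) (binom_monomial I) = 1"
  by (simp add: binom_monomial_lattice_point)

lemma binom_monomial_lattice_point_neq_0:
  assumes "qpoly_eval (lattice_point I) (binom_monomial J) \<noteq> 0"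
  shows "multi_degree J \<le> multi_degree I" "multi_degree J = multi_degree I \<Longrightarrow> J = I"
proof -
  have le: "Poly_Mapping.lookup J x \<le> Poly_Mapping.lookup I x" for x
  proof (cases "x \<in> Poly_Mapping.keys J")
    case True
    then have "Poly_Mapping.lookup I x choose Poly_Mapping.lookup J x \<noteq> 0"
      using assms by (auto simp: binom_monomial_lattice_point)
    then show ?thesis
      by (simp add: binomial_eq_0_iff)
  qed (simp add: in_keys_iff)
  have keys: "Poly_Mapping.keys J \<subseteq> Poly_Mapping.keys I"
  proof
    fix x assume "x \<in> Poly_Mapping.keys J"
    with le[of x] show "x \<in> Poly_Mapping.keys I"
      by (auto simp: in_keys_iff)
  qed
  have J: "multi_degree J = (\<Sum>x\<in>Poly_Mapping.keys I. Poly_Mapping.lookup J x)"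
    unfolding multi_degree_def
    by (rule sum.mono_neutral_left) (use keys in \<open>auto simp: not_in_keys_iff_lookup_eq_zero\<close>)
  show "multi_degree J \<le> multi_degree I"
    unfolding J unfolding multi_degree_def by (intro sum_mono le)
  assume eq: "multi_degree J = multi_degree I"
  show "J = I"
  proof (rule ccontr)
    assume "J \<noteq> I"
    then obtain x where x: "Poly_Mapping.lookup J x \<noteq> Poly_Mapping.lookup I x"
      by (meson poly_mapping_eqI)
    then have "Poly_Mapping.lookup J x < Poly_Mapping.lookup I x" "x \<in> Poly_Mapping.keys I"
      using le[of x] by (auto simp: in_keys_iff)
    then have "multi_degree J < multi_degree I"
      unfolding J unfolding multi_degree_def
      by (intro sum_strict_mono_ex1 ballI bexI[of _ x] le) auto
    with eq show False by simp
  qed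
qed

lemma binom_monomial_lattice_point_Ints: "qpoly_eval (lattice_point I) (binom_monomial J) \<in> \<int>"
  unfolding binom_monomial_lattice_point by (intro Ints_prod) auto

text \<open>The rational coefficients of an integer-valued polynomial in the binomial basis are integers:
  by induction on the total degree of \<open>I\<close>, evaluation at \<open>I\<close> expresses the coefficient of \<open>I\<close> by
  an integer and coefficients of lower degree.\<close>

theorem Int_poly_binom_basis:
  assumes "p \<in> Int_poly X"
  obtains A and c :: "('x \<Rightarrow>\<^sub>0 nat) \<Rightarrow> int"
  where "finite A" "\<And>I. I \<in> A \<Longrightarrow> Poly_Mapping.keys I \<subseteq> X"
    "p = (\<Sum>I\<in>A. of_int (c I) * binom_monomial I)"
proof -
  have "p \<in> binom_span X"
    using assms by (intro binom_span_all) (simp add: Int_poly_def)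
  then obtain A c where A: "finite A" "\<forall>I\<in>A. Poly_Mapping.keys I \<subseteq> X"
      "p = (\<Sum>I\<in>A. Poly_Mapping.single 0 (c I) * binom_monomial I)"
    by (auto simp: binom_span_def)
  have c: "c I \<in> \<int>" if "I \<in> A" for I
    using that
  proof (induction I rule: measure_induct_rule[of multi_degree])
    case (less I)
    let ?e = "\<lambda>J. qpoly_eval (lattice_point I) (binom_monomial J)"
    have "qpoly_eval (lattice_point I) p = (\<Sum>J\<in>A. c J * ?e J)"
      unfolding A(3) by (simp add: qpoly_eval_sum qpoly_eval_mult qpoly_eval_const)
    also have "\<dots> = c I + (\<Sum>J\<in>A - {I}. c J * ?e J)"
      using A(1) less.prems by (simp add: sum.remove binom_monomial_lattice_point_same)
    finally have "c I = qpoly_eval (lattice_point I) p - (\<Sum>J\<in>A - {I}. c J * ?e J)"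
      by simp
    moreover have "c J * ?e J \<in> \<int>" if "J \<in> A - {I}" for J
    proof (cases "?e J = 0")
      case False
      then have "multi_degree J < multi_degree I"
        using binom_monomial_lattice_point_neq_0[of I J] that by force
      then show ?thesis
        using less.IH[of J] that binom_monomial_lattice_point_Ints[of I J] by simp
    qed simp
    then have "(\<Sum>J\<in>A - {I}. c J * ?e J) \<in> \<int>"
      by (rule Ints_sum)
    moreover have "qpoly_eval (lattice_point I) p \<in> \<int>"
      using assms by (simp add: Int_poly_def)
    ultimately show ?case
      by simp
  qed
  define c' where "c' = (\<lambda>I. \<lfloor>c I\<rfloor>)"
  have "of_int (c' I) = c I" if "I \<in> A" for I
    using c[OF that] by (auto simp: c'_def elim!: Ints_cases)
  then have "p = (\<Sum>I\<in>A. of_int (c' I) * binom_monomial I)"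
    unfolding A(3) by (intro sum.cong refl) (simp flip: single_of_int)
  with A that show thesis by blast
qed

lemma m_ideal_iff: "p \<in> m_ideal X \<longleftrightarrow> p \<in> Int_poly X \<and> qpoly_eval (\<lambda>_. 0) p = 0"
  by (simp add: m_ideal_def qpoly_eval_zero)

lemma m_ideal_binom_monomial:
  assumes "Poly_Mapping.keys I \<subseteq> X" "I \<noteq> 0"
  shows "binom_monomial I \<in> m_ideal X"
proof -
  have "multi_degree I \<noteq> 0"
  proof -
    obtain x where "x \<in> Poly_Mapping.keys I"
      using assms(2) by (metis all_not_in_conv keys_eq_empty)
    then show ?thesis
      by (auto simp: multi_degree_def in_keys_iff)
  qed
  then have "qpoly_eval (lattice_point 0) (binom_monomial I) = 0"
    using binom_monomial_lattice_point_neq_0(1)[of 0 I] by (auto simp: multi_degree_def)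
  then have "qpoly_eval (\<lambda>_. 0) (binom_monomial I) = 0"
    by (simp add: lattice_point_0)
  then show ?thesis
    using assms by (simp add: m_ideal_iff Int_poly_binom_monomial)
qed

lemma m_ideal_binom_basis:
  assumes "p \<in> m_ideal X"
  obtains A and c :: "('x \<Rightarrow>\<^sub>0 nat) \<Rightarrow> int"
  where "finite A" "\<And>I. I \<in> A \<Longrightarrow> Poly_Mapping.keys I \<subseteq> X \<and> I \<noteq> 0"
    "p = (\<Sum>I\<in>A. of_int (c I) * binom_monomial I)"
proof -
  have p: "p \<in> Int_poly X" "qpoly_eval (\<lambda>_. 0) p = 0"
    using assms by (auto simp: m_ideal_iff)
  obtain A c where A: "finite A" "\<And>I. I \<in> A \<Longrightarrow> Poly_Mapping.keys I \<subseteq> X"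
      "p = (\<Sum>I\<in>A. of_int (c I) * binom_monomial I)"
    using Int_poly_binom_basis[OF p(1)] by blast
  let ?q = "\<Sum>I\<in>A - {0}. of_int (c I) * binom_monomial I"
  have q: "qpoly_eval (\<lambda>_. 0) ?q = 0"
    unfolding qpoly_eval_sum qpoly_eval_mult
  proof (intro sum.neutral ballI)
    fix I assume "I \<in> A - {0}"
    then have "binom_monomial I \<in> m_ideal X"
      by (intro m_ideal_binom_monomial) (auto simp: A(2))
    then show "qpoly_eval (\<lambda>_. 0) (of_int (c I)) * qpoly_eval (\<lambda>_. 0) (binom_monomial I) = 0"
      by (simp add: m_ideal_iff)
  qed
  show thesis
  proof (cases "0 \<in> A")
    case True
    then have "p = of_int (c 0) + ?q"
      unfolding A(3) using A(1) by (simp add: sum.remove[of A 0])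
    then have "of_int (c 0) = (0 :: rat)"
      using p(2) q by (simp add: qpoly_eval_add)
    then have "p = ?q"
      using \<open>p = of_int (c 0) + ?q\<close> by simp
    with A that[of "A - {0}" c] show thesis by simp
  next
    case False
    then show thesis
      using A by (intro that[of A c]) auto
  qed
qed

lemma m_ideal_0: "0 \<in> m_ideal X"
  by (simp add: m_ideal_iff Int_poly_0)

lemma m_ideal_add: "p \<in> m_ideal X \<Longrightarrow> q \<in> m_ideal X \<Longrightarrow> p + q \<in> m_ideal X"
  by (simp add: m_ideal_iff Int_poly_add qpoly_eval_add)

lemma m_ideal_uminus: "p \<in> m_ideal X \<Longrightarrow> - p \<in> m_ideal X"
  by (simp add: m_ideal_iff Int_poly_uminus qpoly_eval_uminus)

lemma m_ideal_mult: "p \<in> m_ideal X \<Longrightarrow> q \<in> m_ideal X \<Longrightarrow> p * q \<in> m_ideal X"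
  by (simp add: m_ideal_iff Int_poly_mult qpoly_eval_mult)

text \<open>Subtracting the constant term, which is an integer.\<close>

lemma m_ideal_minus_const:
  assumes "q \<in> Int_poly X"
  shows "q - of_int \<lfloor>qpoly_eval (\<lambda>_. 0) q\<rfloor> \<in> m_ideal X"
    "of_int \<lfloor>qpoly_eval (\<lambda>_. 0) q\<rfloor> = qpoly_eval (\<lambda>_. 0) q"
proof -
  have "qpoly_eval (\<lambda>_. 0) q \<in> \<int>"
    using assms by (simp add: Int_poly_def)
  then show *: "of_int \<lfloor>qpoly_eval (\<lambda>_. 0) q\<rfloor> = qpoly_eval (\<lambda>_. 0) q"
    by (auto elim: Ints_cases)
  show "q - of_int \<lfloor>qpoly_eval (\<lambda>_. 0) q\<rfloor> \<in> m_ideal X"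
    using assms by (simp add: m_ideal_iff qpoly_eval_diff * Int_poly_diff Int_poly_of_int)
qed

section \<open>Translation of integer-valued polynomials\<close>

text \<open>The functions of two points that are sums of products of integer-valued polynomials in
  either point.\<close>

inductive_set separable :: "'x set \<Rightarrow> (('x \<Rightarrow> int) \<Rightarrow> ('x \<Rightarrow> int) \<Rightarrow> rat) set" for X where
  tensor: "p \<in> Int_poly X \<Longrightarrow> q \<in> Int_poly X \<Longrightarrow> (\<lambda>v w. qpoly_eval v p * qpoly_eval w q) \<in> separable X"
| add: "G \<in> separable X \<Longrightarrow> H \<in> separable X \<Longrightarrow> (\<lambda>v w. G v w + H v w) \<in> separable X"

lemma separable_const: "(\<lambda>v w. of_int k) \<in> separable X"
  using separable.tensor[OF Int_poly_of_int[of k] Int_poly_1] by simp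

lemma separable_sum: "(\<And>a. a \<in> A \<Longrightarrow> G a \<in> separable X) \<Longrightarrow> (\<lambda>v w. \<Sum>a\<in>A. G a v w) \<in> separable X"
proof (induction A rule: infinite_finite_induct)
  case (insert a A)
  then show ?case by (simp add: separable.add)
qed (use separable_const[of 0] in auto)

lemma separable_mult:
  assumes "G \<in> separable X" "H \<in> separable X"
  shows "(\<lambda>v w. G v w * H v w) \<in> separable X"
  using assms
proof induction
  case (tensor p q)
  from tensor(3) show ?case
  proof induction
    case (tensor p' q')
    have "(\<lambda>v w. qpoly_eval v (p * p') * qpoly_eval w (q * q')) \<in> separable X"
      by (intro separable.tensor Int_poly_mult tensor \<open>p \<in> _\<close> \<open>q \<in> _\<close>)
    then show ?case
      by (simp add: qpoly_eval_mult mult_ac)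
  next
    case (add G H)
    then show ?case
      using separable.add by (fastforce simp: distrib_left)
  qed
next
  case (add G G')
  then show ?case
    using separable.add by (fastforce simp: distrib_right)
qed

lemma separable_prod: "(\<And>a. a \<in> A \<Longrightarrow> G a \<in> separable X) \<Longrightarrow> (\<lambda>v w. \<Prod>a\<in>A. G a v w) \<in> separable X"
proof (induction A rule: infinite_finite_induct)
  case (insert a A)
  then show ?case by (simp add: separable_mult)
qed (use separable_const[of 1] in auto)

text \<open>Translation gives a comultiplication on the integer-valued polynomials. For the binomial
  coefficient of a single variable this is Vandermonde's identity, and the general case follows from
  the binomial basis, since the separable functions are closed under sums and products.\<close>

theorem separable_translate:
  assumes "p \<in> Int_poly X"
  shows "(\<lambda>v w. qpoly_eval (\<lambda>x. v x + w x) p) \<in> separable X"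
proof -
  have binom: "(\<lambda>v w. (of_int (v x + w x) gchoose k)) \<in> separable X" if "x \<in> X" for x k
  proof -
    have "(\<lambda>v w. \<Sum>j\<in>{..k}. qpoly_eval v (binom_poly (Var x) j) *
        qpoly_eval w (binom_poly (Var x) (k - j))) \<in> separable X"
      by (intro separable_sum separable.tensor Int_poly_binom_poly Int_poly_Var that)
    then show ?thesis
      by (simp add: binom_poly_eval gbinomial_Vandermonde atLeast0AtMost[symmetric])
  qed
  obtain A c where A: "finite A" "\<And>I. I \<in> A \<Longrightarrow> Poly_Mapping.keys I \<subseteq> X"
      "p = (\<Sum>I\<in>A. of_int (c I) * binom_monomial I)"
    using Int_poly_binom_basis[OF assms] by blast
  have "(\<lambda>v w. \<Sum>I\<in>A. of_int (c I) *
      (\<Prod>x\<in>Poly_Mapping.keys I. of_int (v x + w x) gchoose Poly_Mapping.lookup I x)) \<in> separable X"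
    using A(2) by (intro separable_sum separable_mult separable_const separable_prod binom) auto
  then show ?thesis
    by (simp add: A(3) qpoly_eval_sum qpoly_eval_mult binom_monomial_def qpoly_eval_prod
        binom_poly_eval)
qed

section \<open>The free ring on a set\<close>

lemma frag_extend_fun_diff:
  "frag_extend (\<lambda>u. F u - G u) f = frag_extend F f - frag_extend G f"
  by (simp add: frag_extend_def frag_cmul_def[symmetric] sum_subtractf[symmetric]
      poly_mapping_eq_iff fun_eq_iff lookup_sum lookup_minus right_diff_distrib)

lemma frag_extend_fun_0: "frag_extend (\<lambda>u. 0) f = 0"
  by (simp add: frag_extend_def)

lemma word_mult_of: "word_mult (frag_of u) (frag_of v) = frag_of (u @ v)"
  by (simp add: word_mult_def)

lemma word_mult_diff_left: "word_mult (f - f') g = word_mult f g - word_mult f' g"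
  by (simp add: word_mult_def frag_extend_diff)

lemma word_mult_diff_right: "word_mult f (g - g') = word_mult f g - word_mult f g'"
  by (simp add: word_mult_def frag_extend_diff frag_extend_fun_diff)

lemma word_mult_0 [simp]: "word_mult 0 g = 0" "word_mult f 0 = 0"
  by (simp_all add: word_mult_def frag_extend_fun_0)

lemma word_mult_minus_left: "word_mult (- f) g = - word_mult f g"
  using word_mult_diff_left[of 0 f g] by simp

lemma word_mult_minus_right: "word_mult f (- g) = - word_mult f g"
  using word_mult_diff_right[of f 0 g] by simp

lemma word_mult_add_left: "word_mult (f + f') g = word_mult f g + word_mult f' g"
  using word_mult_diff_left[of f "- f'" g] by (simp add: word_mult_minus_left)

lemma word_mult_add_right: "word_mult f (g + g') = word_mult f g + word_mult f g'"
  using word_mult_diff_right[of f g "- g'"] by (simp add: word_mult_minus_right)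

lemma word_mult_assoc: "word_mult (word_mult f g) h = word_mult f (word_mult g h)"
proof -
  have 1: "word_mult (word_mult (frag_of u) (frag_of v)) h = word_mult (frag_of u) (word_mult (frag_of v) h)"
    for u v using subset_UNIV[of "Poly_Mapping.keys h"]
    by (induction h rule: frag_induction) (simp_all add: word_mult_of word_mult_diff_right)
  have 2: "word_mult (word_mult (frag_of u) g) h = word_mult (frag_of u) (word_mult g h)"
    for u using subset_UNIV[of "Poly_Mapping.keys g"]
    by (induction g rule: frag_induction) (simp_all add: 1 word_mult_diff_right word_mult_diff_left)
  show ?thesis using subset_UNIV[of "Poly_Mapping.keys f"]
    by (induction f rule: frag_induction) (simp_all add: 2 word_mult_diff_left)
qed

lemma word_mult_one: "word_mult (frag_of []) f = f" "word_mult f (frag_of []) = f"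
  using subset_UNIV[of "Poly_Mapping.keys f"]
  by (induction f rule: frag_induction)
    (simp_all add: word_mult_of word_mult_diff_right word_mult_diff_left)

lemma keys_word_mult:
  "Poly_Mapping.keys (word_mult f g) \<subseteq>
     (\<Union>u\<in>Poly_Mapping.keys f. \<Union>v\<in>Poly_Mapping.keys g. {u @ v})"
proof -
  have "Poly_Mapping.keys (frag_extend (\<lambda>v. frag_of (u @ v)) g) \<subseteq>
      (\<Union>v\<in>Poly_Mapping.keys g. {u @ v})" for u
    using keys_frag_extend[of "\<lambda>v. frag_of (u @ v)" g] by simp
  then show ?thesis
    unfolding word_mult_def by (intro order_trans[OF keys_frag_extend] UN_mono) auto
qed

lemma free_ring_simps [simp]:
  "f \<in> carrier (free_ring S) \<longleftrightarrow> Poly_Mapping.keys f \<subseteq> lists S"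
  "monoid.mult (free_ring S) = word_mult" "\<one>\<^bsub>free_ring S\<^esub> = frag_of []"
  "\<zero>\<^bsub>free_ring S\<^esub> = 0" "ring.add (free_ring S) = (+)"
  by (simp_all add: free_ring_def)

lemma keys_word_mult_lists:
  assumes "Poly_Mapping.keys f \<subseteq> lists S" "Poly_Mapping.keys g \<subseteq> lists S"
  shows "Poly_Mapping.keys (word_mult f g) \<subseteq> lists S"
proof
  fix w assume "w \<in> Poly_Mapping.keys (word_mult f g)"
  then obtain u v where "w = u @ v" "u \<in> Poly_Mapping.keys f" "v \<in> Poly_Mapping.keys g"
    using keys_word_mult[of f g] by blast
  then show "w \<in> lists S"
    using assms by auto
qed

lemma keys_add_subset:
  "Poly_Mapping.keys f \<subseteq> A \<Longrightarrow> Poly_Mapping.keys g \<subseteq> A \<Longrightarrow> Poly_Mapping.keys (f + g) \<subseteq> A"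
  using keys_add[of f g] by blast

lemma keys_diff_subset:
  fixes f g :: "'a \<Rightarrow>\<^sub>0 int"
  shows "Poly_Mapping.keys f \<subseteq> A \<Longrightarrow> Poly_Mapping.keys g \<subseteq> A \<Longrightarrow> Poly_Mapping.keys (f - g) \<subseteq> A"
  using keys_diff[of f g] by blast

lemma ring_free_ring: "ring (free_ring S)"
proof (rule ringI)
  show "abelian_group (free_ring S)"
  proof (rule abelian_groupI)
    fix f assume "f \<in> carrier (free_ring S)"
    then show "\<exists>g\<in>carrier (free_ring S). g \<oplus>\<^bsub>free_ring S\<^esub> f = \<zero>\<^bsub>free_ring S\<^esub>"
      by (intro bexI[of _ "- f"]) auto
  qed (auto simp: keys_add_subset add_ac)
  show "Group.monoid (free_ring S)"
    by (rule monoidI) (auto simp: keys_word_mult_lists word_mult_assoc word_mult_one)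
qed (auto simp: word_mult_add_left word_mult_add_right)

lemma free_ring_a_inv:
  assumes "Poly_Mapping.keys f \<subseteq> lists S"
  shows "\<ominus>\<^bsub>free_ring S\<^esub> f = - f"
proof -
  interpret ring "free_ring S" by (rule ring_free_ring)
  show ?thesis
    by (rule minus_equality) (use assms in auto)
qed

section \<open>Words as functions of several points\<close>

text \<open>A word of polynomials acts on a list of as many points by the product of the values; it
  vanishes on lists of other lengths. The functions on lists of points are thought of as
  inhomogeneous cochains of the additive group of points.\<close>

fun word_eval :: "'x qpoly list \<Rightarrow> ('x \<Rightarrow> int) list \<Rightarrow> rat" where
  "word_eval [] [] = 1"
| "word_eval (p # w) (v # vs) = qpoly_eval v p * word_eval w vs"
| "word_eval _ _ = 0"

definition cochain :: "('x qpoly list \<Rightarrow>\<^sub>0 int) \<Rightarrow> ('x \<Rightarrow> int) list \<Rightarrow> rat" where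
  "cochain f vs = (\<Sum>w\<in>Poly_Mapping.keys f. of_int (Poly_Mapping.lookup f w) * word_eval w vs)"

lemma word_eval_length: "length w \<noteq> length vs \<Longrightarrow> word_eval w vs = 0"
  by (induction w vs rule: word_eval.induct) auto

lemma cochain_superset:
  assumes "finite A" "Poly_Mapping.keys f \<subseteq> A"
  shows "cochain f vs = (\<Sum>w\<in>A. of_int (Poly_Mapping.lookup f w) * word_eval w vs)"
  unfolding cochain_def
  by (rule sum.mono_neutral_left) (use assms in \<open>auto simp: in_keys_iff\<close>)

lemma cochain_0 [simp]: "cochain 0 vs = 0"
  by (simp add: cochain_def)

lemma cochain_of [simp]: "cochain (frag_of w) vs = word_eval w vs"
  by (simp add: cochain_superset[of "{w}"])

lemma cochain_add: "cochain (f + g) vs = cochain f vs + cochain g vs"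
proof -
  let ?A = "Poly_Mapping.keys f \<union> Poly_Mapping.keys g"
  have "Poly_Mapping.keys (f + g) \<subseteq> ?A"
    by (rule keys_add)
  then show ?thesis
    by (simp add: cochain_superset[of ?A] lookup_add sum.distrib distrib_right)
qed

lemma cochain_minus: "cochain (- f) vs = - cochain f vs"
  using cochain_add[of f "- f" vs] by simp

lemma cochain_diff: "cochain (f - g) vs = cochain f vs - cochain g vs"
  using cochain_add[of f "- g" vs] by (simp add: cochain_minus)

lemma cochain_cmul: "cochain (frag_cmul k f) vs = of_int k * cochain f vs"
  by (subst cochain_superset[of "Poly_Mapping.keys f"])
    (auto simp: keys_cmul cochain_def sum_distrib_left mult.assoc)

lemma cochain_length:
  assumes "Poly_Mapping.keys f \<subseteq> {w. length w = n}" "length vs \<noteq> n"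
  shows "cochain f vs = 0"
  unfolding cochain_def using assms by (intro sum.neutral) (auto simp: word_eval_length)

text \<open>The cup product of cochains: the sum of \<open>F us * G ws\<close> over all decompositions of the list of
  arguments as \<open>us @ ws\<close>. In the recursion, a fixed first argument turns a cochain into one of the
  remaining arguments; this slicing is the induction step of the later proofs.\<close>

fun cup :: "('v list \<Rightarrow> rat) \<Rightarrow> ('v list \<Rightarrow> rat) \<Rightarrow> 'v list \<Rightarrow> rat" where
  "cup F G [] = F [] * G []"
| "cup F G (v # vs) = F [] * G (v # vs) + cup (\<lambda>us. F (v # us)) G vs"

lemma cup_0_left [simp]: "cup (\<lambda>_. 0) G vs = 0"
  by (induction vs) auto

lemma cup_0_right [simp]: "cup F (\<lambda>_. 0) vs = 0"
  by (induction vs arbitrary: F) auto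

lemma cup_add_left: "cup (\<lambda>vs. F vs + F' vs) G vs = cup F G vs + cup F' G vs"
  by (induction vs arbitrary: F F') (auto simp: algebra_simps)

lemma cup_diff_left: "cup (\<lambda>vs. F vs - F' vs) G vs = cup F G vs - cup F' G vs"
  by (induction vs arbitrary: F F') (auto simp: algebra_simps)

lemma cup_diff_right: "cup F (\<lambda>vs. G vs - G' vs) vs = cup F G vs - cup F G' vs"
  by (induction vs arbitrary: F) (auto simp: algebra_simps)

lemma cup_scale_left: "cup (\<lambda>vs. c * F vs) G vs = c * cup F G vs"
  by (induction vs arbitrary: F) (auto simp: algebra_simps)

lemma cup_scale_right: "cup F (\<lambda>vs. c * G vs) vs = c * cup F G vs"
  by (induction vs arbitrary: F) (auto simp: algebra_simps)

lemma word_eval_append: "word_eval (u @ w) vs = cup (word_eval u) (word_eval w) vs"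
proof (induction u arbitrary: vs)
  case Nil
  then show ?case by (cases vs) auto
next
  case (Cons p u)
  then show ?case by (cases vs) (auto simp: cup_scale_left)
qed

lemma cochain_mult: "cochain (word_mult f g) vs = cup (cochain f) (cochain g) vs"
proof -
  have 0: "cochain 0 = (\<lambda>_. 0)" "cochain (frag_of w) = word_eval w"
      "cochain (a - b) = (\<lambda>vs. cochain a vs - cochain b vs)" for w and a b :: "'a qpoly list \<Rightarrow>\<^sub>0 int"
    by (auto simp: cochain_diff)
  have 1: "cochain (word_mult (frag_of u) g) vs = cup (word_eval u) (cochain g) vs" for u
    using subset_UNIV[of "Poly_Mapping.keys g"]
    by (induction g rule: frag_induction)
      (simp_all add: word_mult_of word_mult_diff_right 0 cup_diff_right word_eval_append)
  show ?thesis using subset_UNIV[of "Poly_Mapping.keys f"]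
    by (induction f rule: frag_induction) (simp_all add: 0 1 word_mult_diff_left cup_diff_left)
qed

section \<open>The tensor algebra embeds into the cochains\<close>

lemma m_group_simps [simp]:
  "carrier (m_group X) = m_ideal X" "monoid.mult (m_group X) = (+)" "\<one>\<^bsub>m_group X\<^esub> = 0"
  by (simp_all add: m_group_def)

lemma keys_multilinear_relation:
  assumes "a \<in> m_ideal X" "b \<in> m_ideal X"
  shows "Poly_Mapping.keys (frag_of [a + b] - frag_of [a] - frag_of [b]) \<subseteq> lists (m_ideal X)"
  by (intro keys_diff_subset) (use assms in \<open>auto simp: m_ideal_add\<close>)

lemma tensor_ideal_is_ideal: "ideal (tensor_ideal (m_group X)) (free_ring (m_ideal X))"
proof -
  interpret ring "free_ring (m_ideal X)" by (rule ring_free_ring)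
  have "{frag_of [a + b] - frag_of [a] - frag_of [b] | a b. a \<in> m_ideal X \<and> b \<in> m_ideal X}
      \<subseteq> carrier (free_ring (m_ideal X))"
    using keys_multilinear_relation by fastforce
  then show ?thesis
    unfolding tensor_ideal_def m_group_simps by (rule genideal_ideal)
qed

lemma tensor_ideal_carrier:
  "f \<in> tensor_ideal (m_group X) \<Longrightarrow> Poly_Mapping.keys f \<subseteq> lists (m_ideal X)"
  using ideal.Icarr[OF tensor_ideal_is_ideal] by fastforce

lemma tensor_ideal_0: "0 \<in> tensor_ideal (m_group X)"
  using additive_subgroup.zero_closed[OF ideal.axioms(1)[OF tensor_ideal_is_ideal]] by simp

lemma tensor_ideal_add:
  "f \<in> tensor_ideal (m_group X) \<Longrightarrow> g \<in> tensor_ideal (m_group X) \<Longrightarrow>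
   f + g \<in> tensor_ideal (m_group X)"
  using additive_subgroup.a_closed[OF ideal.axioms(1)[OF tensor_ideal_is_ideal]] by fastforce

lemma tensor_ideal_mult_left:
  "f \<in> tensor_ideal (m_group X) \<Longrightarrow> Poly_Mapping.keys g \<subseteq> lists (m_ideal X) \<Longrightarrow>
   word_mult g f \<in> tensor_ideal (m_group X)"
  using ideal.I_l_closed[OF tensor_ideal_is_ideal, of f X g] by simp

lemma tensor_ideal_mult_right:
  "f \<in> tensor_ideal (m_group X) \<Longrightarrow> Poly_Mapping.keys g \<subseteq> lists (m_ideal X) \<Longrightarrow>
   word_mult f g \<in> tensor_ideal (m_group X)"
  using ideal.I_r_closed[OF tensor_ideal_is_ideal, of f X g] by simp

lemma tensor_ideal_minus:
  assumes "f \<in> tensor_ideal (m_group X)"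
  shows "- f \<in> tensor_ideal (m_group X)"
  using tensor_ideal_mult_left[OF assms, of "- frag_of []"]
  by (simp add: word_mult_minus_left word_mult_one)

lemma tensor_ideal_diff:
  "f \<in> tensor_ideal (m_group X) \<Longrightarrow> g \<in> tensor_ideal (m_group X) \<Longrightarrow>
   f - g \<in> tensor_ideal (m_group X)"
  using tensor_ideal_add[of f X "- g"] tensor_ideal_minus[of g X] by simp

lemma tensor_ideal_relation:
  assumes "a \<in> m_ideal X" "b \<in> m_ideal X"
  shows "frag_of [a + b] - frag_of [a] - frag_of [b] \<in> tensor_ideal (m_group X)"
proof -
  interpret ring "free_ring (m_ideal X)" by (rule ring_free_ring)
  have "{frag_of [a + b] - frag_of [a] - frag_of [b] | a b. a \<in> m_ideal X \<and> b \<in> m_ideal X}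
      \<subseteq> carrier (free_ring (m_ideal X))"
    using keys_multilinear_relation by fastforce
  then show ?thesis
    unfolding tensor_ideal_def m_group_simps
    by (rule subsetD[OF genideal_self]) (use assms in blast)
qed

text \<open>The cochain of an element of the free ring only depends on its class, because the elements with
  zero cochain form an ideal that contains the multilinearity relations.\<close>

lemma tensor_ideal_cochain:
  assumes "f \<in> tensor_ideal (m_group X)"
  shows "cochain f vs = 0"
proof -
  interpret ring "free_ring (m_ideal X)" by (rule ring_free_ring)
  define J where "J = {f \<in> carrier (free_ring (m_ideal X)). cochain f = (\<lambda>_. 0)}"
  have "ideal J (free_ring (m_ideal X))"
  proof (rule idealI[OF ring_free_ring])
    show "subgroup J (add_monoid (free_ring (m_ideal X)))"
    proof (rule group.subgroupI[OF a_group])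
      show "J \<noteq> {}"
        by (auto simp: J_def fun_eq_iff intro!: exI[of _ 0])
    next
      fix f assume "f \<in> J"
      then show "inv\<^bsub>add_monoid (free_ring (m_ideal X))\<^esub> f \<in> J"
        unfolding a_inv_def[symmetric] by (simp add: J_def free_ring_a_inv fun_eq_iff cochain_minus)
    qed (auto simp: J_def fun_eq_iff cochain_add keys_add_subset simp del: in_lists_conv_set)
  next
    fix f g assume "f \<in> J" "g \<in> carrier (free_ring (m_ideal X))"
    moreover from this have f: "cochain f = (\<lambda>_. 0)"
      by (simp add: J_def)
    have "cochain (word_mult g f) vs = 0" "cochain (word_mult f g) vs = 0" for vs
      by (simp_all only: cochain_mult f cup_0_left cup_0_right)
    ultimately show "g \<otimes>\<^bsub>free_ring (m_ideal X)\<^esub> f \<in> J" "f \<otimes>\<^bsub>free_ring (m_ideal X)\<^esub> g \<in> J"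
      by (simp_all add: J_def fun_eq_iff keys_word_mult_lists del: in_lists_conv_set)
  qed
  moreover have "frag_of [a + b] - frag_of [a] - frag_of [b] \<in> J"
    if "a \<in> m_ideal X" "b \<in> m_ideal X" for a b
  proof -
    have "cochain (frag_of [a + b] - frag_of [a] - frag_of [b]) vs = 0" for vs
      by (cases "([a], vs)" rule: word_eval.cases)
        (auto simp: cochain_diff qpoly_eval_add distrib_right)
    moreover have "Poly_Mapping.keys (frag_of [a + b] - frag_of [a] - frag_of [b]) \<subseteq> lists (m_ideal X)"
      by (rule keys_multilinear_relation[OF that])
    ultimately show ?thesis
      by (auto simp: J_def)
  qed
  ultimately have "tensor_ideal (m_group X) \<subseteq> J"
    unfolding tensor_ideal_def m_group_simps by (intro genideal_minimal) auto
  with assms show ?thesis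
    by (auto simp: J_def)
qed

text \<open>The combination of words of basis elements whose words of multi-indices are given.\<close>

definition basis_words :: "(('x \<Rightarrow>\<^sub>0 nat) list \<Rightarrow>\<^sub>0 int) \<Rightarrow> ('x qpoly list \<Rightarrow>\<^sub>0 int)" where
  "basis_words = frag_extend (\<lambda>Is. frag_of (map binom_monomial Is))"

lemma basis_words_diff: "basis_words (h - h') = basis_words h - basis_words h'"
  by (simp add: basis_words_def frag_extend_diff)

lemma basis_words_of: "basis_words (frag_of Is) = frag_of (map binom_monomial Is)"
  by (simp add: basis_words_def)

lemma basis_words_mult: "basis_words (word_mult h h') = word_mult (basis_words h) (basis_words h')"
proof -
  have 1: "basis_words (word_mult (frag_of u) h') = word_mult (basis_words (frag_of u)) (basis_words h')"
    for u using subset_UNIV[of "Poly_Mapping.keys h'"]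
    by (induction h' rule: frag_induction)
      (simp_all add: word_mult_of basis_words_of word_mult_diff_right basis_words_diff,
        simp add: basis_words_def)
  show ?thesis using subset_UNIV[of "Poly_Mapping.keys h"]
    by (induction h rule: frag_induction)
      (simp_all add: 1 word_mult_diff_left basis_words_diff, simp add: basis_words_def)
qed

lemma keys_basis_words:
  assumes "Poly_Mapping.keys h \<subseteq> lists {I. Poly_Mapping.keys I \<subseteq> X \<and> I \<noteq> 0}"
  shows "Poly_Mapping.keys (basis_words h) \<subseteq> lists (m_ideal X)"
  using assms keys_frag_extend[of "\<lambda>Is. frag_of (map binom_monomial Is)" h]
  by (fastforce simp: basis_words_def in_lists_conv_set m_ideal_binom_monomial)

text \<open>Evaluation at the lists of lattice points is again triangular, so that the words of basis
  elements are linearly independent as cochains.\<close>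

lemma word_eval_basis_word_neq_0:
  assumes "word_eval (map binom_monomial Js) (map lattice_point Is) \<noteq> 0"
  shows "(\<Sum>J\<leftarrow>Js. multi_degree J) \<le> (\<Sum>I\<leftarrow>Is. multi_degree I) \<and>
    ((\<Sum>J\<leftarrow>Js. multi_degree J) = (\<Sum>I\<leftarrow>Is. multi_degree I) \<longrightarrow> Js = Is)"
  using assms
proof (induction Js arbitrary: Is)
  case Nil
  then show ?case by (cases Is) auto
next
  case (Cons J Js)
  then obtain I Is' where Is: "Is = I # Is'"
    by (cases Is) auto
  have J: "qpoly_eval (lattice_point I) (binom_monomial J) \<noteq> 0"
    and Js: "word_eval (map binom_monomial Js) (map lattice_point Is') \<noteq> 0"
    using Cons.prems by (auto simp: Is)
  show ?case
    using binom_monomial_lattice_point_neq_0[OF J] Cons.IH[OF Js] by (auto simp: Is)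
qed

lemma word_eval_basis_word_same: "word_eval (map binom_monomial Is) (map lattice_point Is) = 1"
  by (induction Is) (auto simp: binom_monomial_lattice_point_same)

lemma cochain_basis_words:
  "cochain (basis_words h) vs =
     (\<Sum>Is\<in>Poly_Mapping.keys h. of_int (Poly_Mapping.lookup h Is) * word_eval (map binom_monomial Is) vs)"
proof -
  have sum: "cochain (sum g A) vs = (\<Sum>a\<in>A. cochain (g a) vs)" if "finite A" for g A
    using that by induction (auto simp: cochain_add)
  show ?thesis
    by (simp add: basis_words_def frag_extend_def sum cochain_cmul)
qed

lemma basis_words_independent:
  assumes "\<And>vs. cochain (basis_words h) vs = 0"
  shows "h = 0"
proof (rule ccontr)
  let ?deg = "\<lambda>Is. \<Sum>I\<leftarrow>Is. multi_degree I"
  assume "h \<noteq> 0"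
  then obtain Is where Is: "Is \<in> Poly_Mapping.keys h"
      and min: "\<And>Js. Js \<in> Poly_Mapping.keys h \<Longrightarrow> ?deg Is \<le> ?deg Js"
    using exists_least_iff[of "\<lambda>n. \<exists>Is\<in>Poly_Mapping.keys h. ?deg Is = n"]
    by (metis (no_types, lifting) all_not_in_conv keys_eq_empty linorder_not_less)
  have "cochain (basis_words h) (map lattice_point Is) =
      (\<Sum>Js\<in>Poly_Mapping.keys h. if Js = Is then of_int (Poly_Mapping.lookup h Is) else 0)"
    unfolding cochain_basis_words
  proof (intro sum.cong refl)
    fix Js assume "Js \<in> Poly_Mapping.keys h"
    then show "of_int (Poly_Mapping.lookup h Js) *
        word_eval (map binom_monomial Js) (map lattice_point Is) =
        (if Js = Is then of_int (Poly_Mapping.lookup h Is) else 0)"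
      using word_eval_basis_word_neq_0[of Js Is] min[of Js]
      by (auto simp: word_eval_basis_word_same)
  qed
  also have "\<dots> = of_int (Poly_Mapping.lookup h Is)"
    using Is by simp
  finally show False
    using assms Is by (simp add: in_keys_iff)
qed

text \<open>Modulo the multilinearity relations every element is a combination of words of basis
  elements.\<close>

lemma basis_words_single:
  assumes "p \<in> m_ideal X"
  shows "\<exists>h. Poly_Mapping.keys h \<subseteq> lists {I. Poly_Mapping.keys I \<subseteq> X \<and> I \<noteq> 0} \<and>
    frag_of [p] - basis_words h \<in> tensor_ideal (m_group X)"
proof -
  let ?L = "lists {I. Poly_Mapping.keys I \<subseteq> X \<and> I \<noteq> 0}"
  define Q where "Q p \<longleftrightarrow> p \<in> m_ideal X \<and> (\<exists>h. Poly_Mapping.keys h \<subseteq> ?L \<and>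
    frag_of [p] - basis_words h \<in> tensor_ideal (m_group X))" for p
  have Q0: "Q 0"
  proof -
    have "frag_of [0 + 0] - frag_of [0] - frag_of [0] \<in> tensor_ideal (m_group X)"
      by (rule tensor_ideal_relation) (rule m_ideal_0)+
    then have "frag_of [0] - basis_words 0 \<in> tensor_ideal (m_group X)"
      using tensor_ideal_minus by (fastforce simp: basis_words_def)
    then show ?thesis
      unfolding Q_def by (intro conjI m_ideal_0 exI[of _ 0]) auto
  qed
  have Qdiff: "Q (a - b)" if ab: "Q a" "Q b" for a b
  proof -
    obtain h where h: "Poly_Mapping.keys h \<subseteq> ?L" "frag_of [a] - basis_words h \<in> tensor_ideal (m_group X)"
      using ab(1) unfolding Q_def by blast
    obtain h' where h': "Poly_Mapping.keys h' \<subseteq> ?L" "frag_of [b] - basis_words h' \<in> tensor_ideal (m_group X)"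
      using ab(2) unfolding Q_def by blast
    have diff: "a - b \<in> m_ideal X"
      using ab m_ideal_add[of a X "- b"] m_ideal_uminus[of b X] by (simp add: Q_def)
    have "frag_of [a - b + b] - frag_of [a - b] - frag_of [b] \<in> tensor_ideal (m_group X)"
      by (rule tensor_ideal_relation) (use ab diff in \<open>auto simp: Q_def\<close>)
    from tensor_ideal_diff[OF tensor_ideal_diff[OF h(2) h'(2)] this]
    have "frag_of [a - b] - basis_words (h - h') \<in> tensor_ideal (m_group X)"
      by (simp add: basis_words_diff algebra_simps)
    with diff show ?thesis
      unfolding Q_def using keys_diff_subset[OF h(1) h'(1)] by blast
  qed
  have Qadd: "Q (a + b)" if "Q a" "Q b" for a b
    using Qdiff[OF that(1) Qdiff[OF Q0 that(2)]] by simp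
  have Qbasis: "Q (binom_monomial I)" if "Poly_Mapping.keys I \<subseteq> X" "I \<noteq> 0" for I
    unfolding Q_def using that tensor_ideal_0
    by (auto simp: m_ideal_binom_monomial basis_words_of intro!: exI[of _ "frag_of [I]"])
  have Qmult: "Q (of_int k * a)" if "Q a" for k a
  proof (induction k rule: int_induct[of _ 0])
    case base
    then show ?case by (simp add: Q0)
  next
    case (step1 i)
    then show ?case using Qadd[OF _ that] by (simp add: distrib_right)
  next
    case (step2 i)
    then show ?case using Qdiff[OF _ that] by (simp add: left_diff_distrib)
  qed
  obtain A c where A: "finite A" "\<And>I. I \<in> A \<Longrightarrow> Poly_Mapping.keys I \<subseteq> X \<and> I \<noteq> 0"
      "p = (\<Sum>I\<in>A. of_int (c I) * binom_monomial I)"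
    using m_ideal_binom_basis[OF assms] by blast
  have "Q p"
    unfolding A(3) using A(1,2)
    by (induction A rule: finite_induct) (auto simp: Q0 Qadd Qmult Qbasis)
  then show ?thesis
    by (simp add: Q_def)
qed

lemma basis_words_spanning:
  assumes "Poly_Mapping.keys f \<subseteq> lists (m_ideal X)"
  shows "\<exists>h. Poly_Mapping.keys h \<subseteq> lists {I. Poly_Mapping.keys I \<subseteq> X \<and> I \<noteq> 0} \<and>
    f - basis_words h \<in> tensor_ideal (m_group X)"
proof -
  let ?L = "lists {I. Poly_Mapping.keys I \<subseteq> X \<and> I \<noteq> 0}"
  have word: "\<exists>h. Poly_Mapping.keys h \<subseteq> ?L \<and> frag_of w - basis_words h \<in> tensor_ideal (m_group X)"
    if "w \<in> lists (m_ideal X)" for w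
    using that
  proof (induction w)
    case Nil
    show ?case
      by (intro exI[of _ "frag_of []"]) (simp add: basis_words_of tensor_ideal_0)
  next
    case (Cons p w)
    obtain h where h: "Poly_Mapping.keys h \<subseteq> ?L" "frag_of w - basis_words h \<in> tensor_ideal (m_group X)"
      using Cons.IH by blast
    obtain k where k: "Poly_Mapping.keys k \<subseteq> ?L" "frag_of [p] - basis_words k \<in> tensor_ideal (m_group X)"
      using basis_words_single[OF Cons.hyps(1)] by blast
    have "word_mult (frag_of [p] - basis_words k) (frag_of w) \<in> tensor_ideal (m_group X)"
      using Cons.hyps by (intro tensor_ideal_mult_right k) auto
    moreover have "word_mult (basis_words k) (frag_of w - basis_words h) \<in> tensor_ideal (m_group X)"
      by (intro tensor_ideal_mult_left h keys_basis_words k)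
    ultimately have "word_mult (frag_of [p] - basis_words k) (frag_of w) +
        word_mult (basis_words k) (frag_of w - basis_words h) \<in> tensor_ideal (m_group X)"
      by (rule tensor_ideal_add)
    then have "frag_of (p # w) - basis_words (word_mult k h) \<in> tensor_ideal (m_group X)"
      by (simp add: word_mult_diff_left word_mult_diff_right word_mult_of basis_words_mult)
    then show ?case
      using keys_word_mult_lists[OF k(1) h(1)] by blast
  qed
  show ?thesis using assms
  proof (induction f rule: frag_induction)
    case zero
    show ?case
      by (intro exI[of _ 0]) (simp add: basis_words_def tensor_ideal_0)
  next
    case (one w)
    then show ?case by (rule word)
  next
    case (diff a b)
    then obtain h h' where h: "Poly_Mapping.keys h \<subseteq> ?L" "a - basis_words h \<in> tensor_ideal (m_group X)"
      and h': "Poly_Mapping.keys h' \<subseteq> ?L" "b - basis_words h' \<in> tensor_ideal (m_group X)"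
      by blast
    have "a - b - basis_words (h - h') \<in> tensor_ideal (m_group X)"
      using tensor_ideal_diff[OF h(2) h'(2)] by (simp add: basis_words_diff algebra_simps)
    then show ?case
      using keys_diff_subset[OF h(1) h'(1)] by blast
  qed
qed

text \<open>The multilinearity relations generate exactly the elements with zero cochain.\<close>

theorem tensor_ideal_iff:
  assumes "Poly_Mapping.keys f \<subseteq> lists (m_ideal X)"
  shows "f \<in> tensor_ideal (m_group X) \<longleftrightarrow> (\<forall>vs. cochain f vs = 0)"
proof
  assume f: "\<forall>vs. cochain f vs = 0"
  obtain h where h: "f - basis_words h \<in> tensor_ideal (m_group X)"
    using basis_words_spanning[OF assms] by blast
  have "cochain (basis_words h) vs = 0" for vs
    using tensor_ideal_cochain[OF h, of vs] f by (simp add: cochain_diff)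
  then have "h = 0"
    by (rule basis_words_independent)
  with h show "f \<in> tensor_ideal (m_group X)"
    by (simp add: basis_words_def)
qed (simp add: tensor_ideal_cochain)

section \<open>The coboundary\<close>

text \<open>The coboundary of inhomogeneous cochains of the additive group of points, with trivial
  coefficients; in degree one it is \<open>(d F)(v, w) = F(v) + F(w) - F(v + w)\<close>. In the recursion the term
  \<open>F (v # vs)\<close> cancels against the next step, unless that is the last one. The form chosen makes the
  coboundary a derivation by inspection: \<open>d\<close> is applied to the first factor of a tensor, and then,
  with a sign, to the remaining ones.\<close>

fun coboundary :: "(('x \<Rightarrow> int) list \<Rightarrow> rat) \<Rightarrow> ('x \<Rightarrow> int) list \<Rightarrow> rat" where
  "coboundary F [] = 0"
| "coboundary F [v] = 0"
| "coboundary F (v # w # vs) = F (v # vs) + F (w # vs) - F ((\<lambda>x. v x + w x) # vs)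
     - coboundary (\<lambda>us. F (v # us)) (w # vs)"

lemma coboundary_add: "coboundary (\<lambda>vs. F vs + G vs) vs = coboundary F vs + coboundary G vs"
  by (induction F vs arbitrary: G rule: coboundary.induct) auto

lemma coboundary_diff: "coboundary (\<lambda>vs. F vs - G vs) vs = coboundary F vs - coboundary G vs"
  by (induction F vs arbitrary: G rule: coboundary.induct) auto

lemma coboundary_0 [simp]: "coboundary (\<lambda>_. 0) vs = 0"
  using coboundary_diff[of "\<lambda>_. 0" "\<lambda>_. 0" vs] by simp

lemma coboundary_scale: "coboundary (\<lambda>vs. c * F vs) vs = c * coboundary F vs"
  by (induction F vs rule: coboundary.induct) (auto simp: algebra_simps)

lemma coboundary_length:
  assumes "\<And>vs. length vs \<noteq> n \<Longrightarrow> F vs = 0" "length vs \<noteq> Suc n"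
  shows "coboundary F vs = 0"
  using assms
proof (induction F vs arbitrary: n rule: coboundary.induct)
  case (3 F v w vs)
  show ?case
  proof (cases n)
    case 0
    then have "(\<lambda>us. F (v # us)) = (\<lambda>_. 0)"
      using 3(2) by (simp add: fun_eq_iff)
    then show ?thesis
      using 3(2,3) 0 by simp
  next
    case (Suc m)
    then have "coboundary (\<lambda>us. F (v # us)) (w # vs) = 0"
      using 3(2,3) by (intro 3(1)[of m]) auto
    then show ?thesis
      using 3(2,3) Suc by simp
  qed
qed auto

text \<open>The square of the coboundary vanishes on all functions of lists of points. For a fixed
  first argument \<open>u\<close>, the function \<open>coboundary F (u # _)\<close> is the function \<open>?A\<close> below minus the
  coboundary of \<open>F (u # _)\<close>, and the coboundary of the latter is zero by the induction hypothesis.\<close>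

lemma coboundary_coboundary: "coboundary (coboundary F) vs = 0"
proof (induction vs arbitrary: F rule: length_induct)
  case (1 vs)
  consider "length vs \<le> 1" | u v where "vs = [u, v]" | u v w ws where "vs = u # v # w # ws"
    by (cases vs; cases "tl vs"; cases "tl (tl vs)") auto
  then show ?case
  proof cases
    case 1
    then show ?thesis
      by (cases vs) auto
  next
    case 2
    then show ?thesis by simp
  next
    case (3 u v w ws)
    let ?A = "\<lambda>us. case us of [] \<Rightarrow> 0
      | x # vs \<Rightarrow> F (u # vs) + F (x # vs) - F ((\<lambda>i. u i + x i) # vs)"
    have "(\<lambda>us. coboundary F (u # us)) = (\<lambda>us. ?A us - coboundary (\<lambda>us. F (u # us)) us)"
    proof
      fix us show "coboundary F (u # us) = ?A us - coboundary (\<lambda>us. F (u # us)) us"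
        by (cases us) auto
    qed
    then have "coboundary (\<lambda>us. coboundary F (u # us)) (v # w # ws) = coboundary ?A (v # w # ws)"
      using 1[rule_format, of "v # w # ws" "\<lambda>us. F (u # us)"] by (simp only: coboundary_diff) (simp add: 3)
    also have "\<dots> = ?A (v # ws) + ?A (w # ws) - ?A ((\<lambda>i. v i + w i) # ws) -
        (coboundary (\<lambda>us. F (u # us)) (w # ws) + coboundary (\<lambda>us. F (v # us)) (w # ws) -
         coboundary (\<lambda>us. F ((\<lambda>i. u i + v i) # us)) (w # ws))"
      by (simp add: coboundary_diff coboundary_add)
    finally show ?thesis
      by (simp add: 3 add.assoc)
  qed
qed

text \<open>Multiplication by the sign of the degree.\<close>

definition alternate :: "('v list \<Rightarrow> rat) \<Rightarrow> 'v list \<Rightarrow> rat" where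
  "alternate F vs = (- 1) ^ length vs * F vs"

text \<open>The graded Leibniz rule.\<close>

lemma coboundary_cup:
  "coboundary (cup F G) vs = cup (coboundary F) G vs + cup (alternate F) (coboundary G) vs"
proof (induction vs arbitrary: F rule: length_induct)
  case (1 vs)
  consider "length vs \<le> 1" | v w ws where "vs = v # w # ws"
    by (cases vs; cases "tl vs") auto
  then show ?case
  proof cases
    case 1
    then show ?thesis
      by (cases vs) auto
  next
    case (2 v w ws)
    let ?Fv = "\<lambda>us. F (v # us)"
    have alt: "(\<lambda>us. alternate F (v # us)) = (\<lambda>us. - 1 * alternate ?Fv us)"
      by (simp add: alternate_def fun_eq_iff)
    have cob: "(\<lambda>us. coboundary F (v # w # us)) =
        (\<lambda>us. F (v # us) + F (w # us) - F ((\<lambda>i. v i + w i) # us) - coboundary ?Fv (w # us))"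
      by (simp add: fun_eq_iff)
    have "coboundary (\<lambda>us. cup F G (v # us)) (w # ws) =
        F [] * coboundary (\<lambda>us. G (v # us)) (w # ws) + coboundary (cup ?Fv G) (w # ws)"
      by (simp add: coboundary_add coboundary_scale)
    also have "coboundary (cup ?Fv G) (w # ws) =
        cup (coboundary ?Fv) G (w # ws) + cup (alternate ?Fv) (coboundary G) (w # ws)"
      using 1 2 by simp
    finally have IH: "coboundary (\<lambda>us. cup F G (v # us)) (w # ws) =
        F [] * coboundary (\<lambda>us. G (v # us)) (w # ws) +
        (cup (coboundary ?Fv) G (w # ws) + cup (alternate ?Fv) (coboundary G) (w # ws))" .
    have lhs: "coboundary (cup F G) vs = cup F G (v # ws) + cup F G (w # ws)
        - cup F G ((\<lambda>i. v i + w i) # ws) - coboundary (\<lambda>us. cup F G (v # us)) (w # ws)"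
      by (simp only: 2 coboundary.simps)
    have rhs1: "cup (coboundary F) G vs =
        cup ?Fv G ws + cup (\<lambda>us. F (w # us)) G ws - cup (\<lambda>us. F ((\<lambda>i. v i + w i) # us)) G ws
        - cup (\<lambda>us. coboundary ?Fv (w # us)) G ws"
      by (simp add: 2 cob cup_diff_left cup_add_left)
    have rhs2: "cup (alternate F) (coboundary G) vs =
        F [] * coboundary G (v # w # ws) - cup (alternate ?Fv) (coboundary G) (w # ws)"
      unfolding 2 cup.simps(2)[of _ _ v] alt cup_scale_left by (simp add: alternate_def)
    show ?thesis
      unfolding lhs rhs1 rhs2 IH by (simp add: algebra_simps)
  qed
qed

section \<open>The coboundary preserves the tensor algebra\<close>

text \<open>In a product \<open>p(v) q(w)\<close>, subtracting the constant terms from \<open>p\<close> and \<open>q\<close> amounts to subtracting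
  the restrictions to \<open>w = 0\<close> and \<open>v = 0\<close> and adding back the value at the origin. The result is the
  cochain of a tensor of degree two.\<close>

lemma separable_cochain:
  assumes "G \<in> separable X"
  shows "\<exists>g. Poly_Mapping.keys g \<subseteq> lists (m_ideal X) \<and> Poly_Mapping.keys g \<subseteq> {w. length w = 2} \<and>
    (\<forall>v w. cochain g [v, w] = G v w - G v (\<lambda>_. 0) - G (\<lambda>_. 0) w + G (\<lambda>_. 0) (\<lambda>_. 0))"
  using assms
proof induction
  case (tensor p q)
  define k l where "k = \<lfloor>qpoly_eval (\<lambda>_. 0) p\<rfloor>" and "l = \<lfloor>qpoly_eval (\<lambda>_. 0) q\<rfloor>"
  note kl = m_ideal_minus_const[OF tensor(1), folded k_def] m_ideal_minus_const[OF tensor(2), folded l_def]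
  show ?case
    using kl(1,3)
    by (intro exI[of _ "frag_of [p - of_int k, q - of_int l]"])
      (simp add: qpoly_eval_diff algebra_simps flip: kl(2,4))
next
  case (add G H)
  then obtain g h where
    "Poly_Mapping.keys g \<subseteq> lists (m_ideal X)" "Poly_Mapping.keys g \<subseteq> {w. length w = 2}"
    "\<forall>v w. cochain g [v, w] = G v w - G v (\<lambda>_. 0) - G (\<lambda>_. 0) w + G (\<lambda>_. 0) (\<lambda>_. 0)"
    "Poly_Mapping.keys h \<subseteq> lists (m_ideal X)" "Poly_Mapping.keys h \<subseteq> {w. length w = 2}"
    "\<forall>v w. cochain h [v, w] = H v w - H v (\<lambda>_. 0) - H (\<lambda>_. 0) w + H (\<lambda>_. 0) (\<lambda>_. 0)"
    by (elim exE conjE)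
  then show ?case
    by (intro exI[of _ "g + h"] conjI keys_add_subset) (auto simp: cochain_add)
qed

lemma coboundary_single:
  assumes "p \<in> m_ideal X"
  shows "\<exists>g. Poly_Mapping.keys g \<subseteq> lists (m_ideal X) \<and> cochain g = coboundary (word_eval [p])"
proof -
  have p: "p \<in> Int_poly X" "qpoly_eval (\<lambda>_. 0) p = 0"
    using assms by (auto simp: m_ideal_iff)
  obtain g where g: "Poly_Mapping.keys g \<subseteq> lists (m_ideal X)" "Poly_Mapping.keys g \<subseteq> {w. length w = 2}"
      "\<And>v w. cochain g [v, w] = qpoly_eval (\<lambda>x. v x + w x) p - qpoly_eval v p - qpoly_eval w p"
    using separable_cochain[OF separable_translate[OF p(1)]] p(2) by auto
  have "cochain (- g) vs = coboundary (word_eval [p]) vs" for vs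
  proof (cases "length vs = 2")
    case True
    then obtain v w where "vs = [v, w]"
      by (auto simp: numeral_2_eq_2 length_Suc_conv)
    then show ?thesis
      by (simp add: cochain_minus g(3))
  next
    case False
    then have "coboundary (word_eval [p]) vs = 0"
      by (intro coboundary_length[of 1]) (auto simp: word_eval_length)
    with False g(2) show ?thesis
      by (simp add: cochain_minus cochain_length)
  qed
  then show ?thesis
    using g(1) by (intro exI[of _ "- g"]) (simp add: fun_eq_iff)
qed

text \<open>By the Leibniz rule it suffices to treat words of length one.\<close>

theorem coboundary_cochain:
  assumes "Poly_Mapping.keys f \<subseteq> lists (m_ideal X)"
  shows "\<exists>g. Poly_Mapping.keys g \<subseteq> lists (m_ideal X) \<and> cochain g = coboundary (cochain f)"
proof -
  have word: "\<exists>g. Poly_Mapping.keys g \<subseteq> lists (m_ideal X) \<and> cochain g = coboundary (word_eval w)"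
    if "w \<in> lists (m_ideal X)" for w
    using that
  proof (induction w)
    case Nil
    have "coboundary (word_eval []) vs = 0" for vs :: "('a \<Rightarrow> int) list"
      by (induction "word_eval [] :: ('a \<Rightarrow> int) list \<Rightarrow> rat" vs rule: coboundary.induct) auto
    then show ?case
      by (intro exI[of _ 0]) (simp add: fun_eq_iff)
  next
    case (Cons p w)
    obtain g where g: "Poly_Mapping.keys g \<subseteq> lists (m_ideal X)" "cochain g = coboundary (word_eval w)"
      using Cons.IH by blast
    obtain h where h: "Poly_Mapping.keys h \<subseteq> lists (m_ideal X)" "cochain h = coboundary (word_eval [p])"
      using coboundary_single[OF Cons.hyps(1)] by blast
    have alt: "alternate (word_eval [p]) = (\<lambda>vs. - 1 * word_eval [p] vs)"
    proof
      fix vs show "alternate (word_eval [p]) vs = - 1 * word_eval [p] vs"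
        by (cases "length vs = 1") (auto simp: alternate_def word_eval_length)
    qed
    have word: "word_eval (p # w) = cup (word_eval [p]) (word_eval w)"
      using word_eval_append[of "[p]" w] by (simp add: fun_eq_iff)
    have sing: "cochain (frag_of u) = word_eval u" for u
      by (simp add: fun_eq_iff)
    have "cochain (word_mult h (frag_of w) - word_mult (frag_of [p]) g) vs =
        coboundary (word_eval (p # w)) vs" for vs
      unfolding word coboundary_cup alt cup_scale_left
      by (simp only: cochain_diff cochain_mult h g sing)
    moreover have "Poly_Mapping.keys (word_mult h (frag_of w) - word_mult (frag_of [p]) g) \<subseteq> lists (m_ideal X)"
      by (intro keys_diff_subset keys_word_mult_lists g h) (use Cons.hyps in auto)
    ultimately show ?case
      by (intro exI[of _ "word_mult h (frag_of w) - word_mult (frag_of [p]) g"]) (simp add: fun_eq_iff)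
  qed
  show ?thesis using assms
  proof (induction f rule: frag_induction)
    case zero
    have "cochain 0 = (\<lambda>_ :: ('a \<Rightarrow> int) list. 0)"
      by (simp add: fun_eq_iff)
    then show ?case
      by (intro exI[of _ 0]) (simp add: fun_eq_iff)
  next
    case (one w)
    moreover have "cochain (frag_of w) = word_eval w"
      by (simp add: fun_eq_iff)
    ultimately show ?case
      using word by simp
  next
    case (diff a b)
    then obtain g h where gh: "Poly_Mapping.keys g \<subseteq> lists (m_ideal X)" "cochain g = coboundary (cochain a)"
        "Poly_Mapping.keys h \<subseteq> lists (m_ideal X)" "cochain h = coboundary (cochain b)"
      by blast
    have "cochain (a - b) = (\<lambda>vs. cochain a vs - cochain b vs)"
      by (simp add: fun_eq_iff cochain_diff)
    then have "cochain (g - h) vs = coboundary (cochain (a - b)) vs" for vs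
      by (simp only: cochain_diff gh coboundary_diff)
    then have "cochain (g - h) = coboundary (cochain (a - b))"
      by (simp add: fun_eq_iff)
    then show ?case
      using keys_diff_subset[OF gh(1,3)] by blast
  qed
qed

section \<open>The free binomial graded algebra as a ring of cochains\<close>

lemma tensor_class_eq: "tensor_class (m_group X) f = {g. g - f \<in> tensor_ideal (m_group X)}"
proof -
  have "tensor_class (m_group X) f = {h + f | h. h \<in> tensor_ideal (m_group X)}"
    by (auto simp: tensor_class_def a_r_coset_def r_coset_def)
  also have "\<dots> = {g. g - f \<in> tensor_ideal (m_group X)}"
    by (metis (no_types, opaque_lifting) add_diff_cancel_right' diff_add_cancel)
  finally show ?thesis .
qed

lemma tensor_class_member:
  assumes "Poly_Mapping.keys f \<subseteq> lists (m_ideal X)" "g \<in> tensor_class (m_group X) f"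
  shows "Poly_Mapping.keys g \<subseteq> lists (m_ideal X)" "cochain g = cochain f"
proof -
  have gf: "g - f \<in> tensor_ideal (m_group X)"
    using assms(2) by (simp add: tensor_class_eq)
  show "Poly_Mapping.keys g \<subseteq> lists (m_ideal X)"
    using keys_add_subset[OF tensor_ideal_carrier[OF gf] assms(1)] by simp
  show "cochain g = cochain f"
    using tensor_ideal_cochain[OF gf] by (simp add: fun_eq_iff cochain_diff)
qed

lemma tensor_class_self: "f \<in> tensor_class (m_group X) f"
  by (simp add: tensor_class_eq tensor_ideal_0)

lemma tensor_class_eq_iff:
  assumes "Poly_Mapping.keys f \<subseteq> lists (m_ideal X)" "Poly_Mapping.keys g \<subseteq> lists (m_ideal X)"
  shows "tensor_class (m_group X) f = tensor_class (m_group X) g \<longleftrightarrow> cochain f = cochain g"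
proof
  assume "tensor_class (m_group X) f = tensor_class (m_group X) g"
  then show "cochain f = cochain g"
    using tensor_class_self[of f X] assms(2) tensor_class_member(2) by metis
next
  assume "cochain f = cochain g"
  then have fg: "f - g \<in> tensor_ideal (m_group X)"
    using assms by (subst tensor_ideal_iff) (auto simp: cochain_diff keys_diff_subset simp del: in_lists_conv_set)
  have "h - f \<in> tensor_ideal (m_group X) \<longleftrightarrow> h - g \<in> tensor_ideal (m_group X)" for h
    using tensor_ideal_add[OF _ fg, of "h - f"] tensor_ideal_diff[OF _ fg, of "h - g"] by auto
  then show "tensor_class (m_group X) f = tensor_class (m_group X) g"
    by (simp add: tensor_class_eq)
qed

lemma T_carrier: "carrier (T_alg X) = tensor_class (m_group X) ` {f. Poly_Mapping.keys f \<subseteq> lists (m_ideal X)}"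
  by (auto simp: T_alg_def tensor_algebra_def Let_def FactRing_def A_RCOSETS_def RCOSETS_def
      tensor_class_def a_r_coset_def simp del: in_lists_conv_set)

lemma T_ring: "ring (T_alg X)"
proof -
  interpret Q: ring "free_ring (m_ideal X) Quot tensor_ideal (m_group X)"
    by (rule ideal.quotient_is_ring[OF tensor_ideal_is_ideal])
  show ?thesis
  proof (rule ringI)
    show "abelian_group (T_alg X)"
      by (rule abelian_groupI)
        (auto simp: T_alg_def tensor_algebra_def Let_def Q.a_ac intro: Q.l_neg Q.a_inv_closed)
    show "Group.monoid (T_alg X)"
      by (rule monoidI) (auto simp: T_alg_def tensor_algebra_def Let_def Q.m_assoc)
  qed (auto simp: T_alg_def tensor_algebra_def Let_def Q.l_distr Q.r_distr)
qed

lemma T_zero: "\<zero>\<^bsub>T_alg X\<^esub> = tensor_class (m_group X) 0"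
  by (simp add: T_alg_def tensor_algebra_def Let_def FactRing_def tensor_class_eq)

lemma T_one: "\<one>\<^bsub>T_alg X\<^esub> = tensor_class (m_group X) (frag_of [])"
  by (simp add: T_alg_def tensor_algebra_def Let_def FactRing_def tensor_class_def)

lemma T_add:
  assumes "Poly_Mapping.keys f \<subseteq> lists (m_ideal X)" "Poly_Mapping.keys g \<subseteq> lists (m_ideal X)"
  shows "tensor_class (m_group X) f \<oplus>\<^bsub>T_alg X\<^esub> tensor_class (m_group X) g = tensor_class (m_group X) (f + g)"
  using ideal.a_rcos_sum[OF tensor_ideal_is_ideal, of f X g] assms
  by (simp add: T_alg_def tensor_algebra_def Let_def FactRing_def tensor_class_def)

lemma T_mult:
  assumes "Poly_Mapping.keys f \<subseteq> lists (m_ideal X)" "Poly_Mapping.keys g \<subseteq> lists (m_ideal X)"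
  shows "tensor_class (m_group X) f \<otimes>\<^bsub>T_alg X\<^esub> tensor_class (m_group X) g = tensor_class (m_group X) (word_mult f g)"
  using ideal.rcoset_mult_add[OF tensor_ideal_is_ideal, of f X g] assms
  by (simp add: T_alg_def tensor_algebra_def Let_def FactRing_def tensor_class_def)

lemma T_smult:
  assumes "Poly_Mapping.keys f \<subseteq> lists (m_ideal X)"
  shows "k \<odot>\<^bsub>T_alg X\<^esub> tensor_class (m_group X) f = tensor_class (m_group X) (frag_cmul k f)"
proof -
  let ?F = "free_ring (m_ideal X)" and ?Q = "free_ring (m_ideal X) Quot tensor_ideal (m_group X)"
  interpret F: ring ?F by (rule ring_free_ring)
  interpret Q: ring ?Q by (rule ideal.quotient_is_ring[OF tensor_ideal_is_ideal])
  have "(\<lambda>f. tensor_ideal (m_group X) +>\<^bsub>?F\<^esub> f) \<in> hom (add_monoid ?F) (add_monoid ?Q)"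
    using ideal.rcos_ring_hom[OF tensor_ideal_is_ideal, of X]
    by (simp add: ring_hom_def hom_def)
  then have "group_hom (add_monoid ?F) (add_monoid ?Q) (\<lambda>f. tensor_ideal (m_group X) +>\<^bsub>?F\<^esub> f)"
    by (intro group_hom.intro group_hom_axioms.intro F.a_group Q.a_group)
  then have "[k] \<cdot>\<^bsub>?Q\<^esub> (tensor_ideal (m_group X) +>\<^bsub>?F\<^esub> f) = tensor_ideal (m_group X) +>\<^bsub>?F\<^esub> ([k] \<cdot>\<^bsub>?F\<^esub> f)"
    using group_hom.hom_int_pow[of "add_monoid ?F" "add_monoid ?Q" _ f k] assms
    by (simp add: add_pow_def)
  also have "[k] \<cdot>\<^bsub>?F\<^esub> f = frag_cmul k f"
  proof -
    have "add_monoid ?F = free_Abelian_group (lists (m_ideal X))"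
      by (simp add: free_ring_def free_Abelian_group_def)
    then show ?thesis
      using assms by (simp add: add_pow_def)
  qed
  finally show ?thesis
    by (simp add: T_alg_def tensor_algebra_def Let_def tensor_class_def)
qed

text \<open>The cochain of an element of the tensor algebra; every representative gives the same one.\<close>

definition T_cochain :: "'x free_binomial \<Rightarrow> ('x \<Rightarrow> int) list \<Rightarrow> rat" where
  "T_cochain U = cochain (SOME f. f \<in> U)"

lemma T_cochain_class:
  assumes "Poly_Mapping.keys f \<subseteq> lists (m_ideal X)"
  shows "T_cochain (tensor_class (m_group X) f) = cochain f"
  unfolding T_cochain_def
  by (rule tensor_class_member(2)[OF assms]) (rule someI, rule tensor_class_self)

lemma T_carrierE:
  assumes "U \<in> carrier (T_alg X)"
  obtains f where "Poly_Mapping.keys f \<subseteq> lists (m_ideal X)" "U = tensor_class (m_group X) f"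
    "T_cochain U = cochain f"
  using assms T_cochain_class by (auto simp: T_carrier simp del: in_lists_conv_set)

lemma T_carrierI:
  "Poly_Mapping.keys f \<subseteq> lists (m_ideal X) \<Longrightarrow> tensor_class (m_group X) f \<in> carrier (T_alg X)"
  by (auto simp: T_carrier)

theorem T_cochain_inject:
  assumes "U \<in> carrier (T_alg X)" "V \<in> carrier (T_alg X)" "\<And>vs. T_cochain U vs = T_cochain V vs"
  shows "U = V"
  using assms by (elim T_carrierE) (simp add: tensor_class_eq_iff fun_eq_iff del: in_lists_conv_set)

lemma T_cochain_zero [simp]: "T_cochain \<zero>\<^bsub>T_alg X\<^esub> vs = 0"
  by (simp add: T_zero T_cochain_class)

lemma T_cochain_one: "T_cochain \<one>\<^bsub>T_alg X\<^esub> = word_eval []"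
  by (simp add: T_one T_cochain_class fun_eq_iff)

lemma T_cochain_add:
  "U \<in> carrier (T_alg X) \<Longrightarrow> V \<in> carrier (T_alg X) \<Longrightarrow>
   T_cochain (U \<oplus>\<^bsub>T_alg X\<^esub> V) vs = T_cochain U vs + T_cochain V vs"
  by (elim T_carrierE) (simp add: T_add T_cochain_class keys_add_subset cochain_add del: in_lists_conv_set)

lemma T_cochain_mult:
  "U \<in> carrier (T_alg X) \<Longrightarrow> V \<in> carrier (T_alg X) \<Longrightarrow>
   T_cochain (U \<otimes>\<^bsub>T_alg X\<^esub> V) vs = cup (T_cochain U) (T_cochain V) vs"
  by (elim T_carrierE) (simp add: T_mult T_cochain_class keys_word_mult_lists cochain_mult del: in_lists_conv_set)

lemma T_smult_closed:
  assumes "U \<in> carrier (T_alg X)"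
  shows "k \<odot>\<^bsub>T_alg X\<^esub> U \<in> carrier (T_alg X)" "T_cochain (k \<odot>\<^bsub>T_alg X\<^esub> U) vs = of_int k * T_cochain U vs"
proof -
  obtain f where f: "Poly_Mapping.keys f \<subseteq> lists (m_ideal X)" "U = tensor_class (m_group X) f"
      "T_cochain U = cochain f"
    using assms by (rule T_carrierE)
  have k: "Poly_Mapping.keys (frag_cmul k f) \<subseteq> lists (m_ideal X)"
    using keys_cmul[of k f] f(1) by (rule order_trans)
  show "k \<odot>\<^bsub>T_alg X\<^esub> U \<in> carrier (T_alg X)" "T_cochain (k \<odot>\<^bsub>T_alg X\<^esub> U) vs = of_int k * T_cochain U vs"
    unfolding f(2) by (simp_all only: T_smult[OF f(1)] T_carrierI[OF k] T_cochain_class[OF k]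
        T_cochain_class[OF f(1)] cochain_cmul)
qed

lemma T_cochain_minus:
  assumes "U \<in> carrier (T_alg X)"
  shows "T_cochain (\<ominus>\<^bsub>T_alg X\<^esub> U) vs = - T_cochain U vs"
proof -
  interpret ring "T_alg X" by (rule T_ring)
  have "T_cochain (U \<oplus>\<^bsub>T_alg X\<^esub> \<ominus>\<^bsub>T_alg X\<^esub> U) vs = 0"
    using assms by (simp add: r_neg)
  then show ?thesis
    using assms by (simp add: T_cochain_add)
qed

lemma T_cochain_diff:
  assumes "U \<in> carrier (T_alg X)" "V \<in> carrier (T_alg X)"
  shows "T_cochain (U \<ominus>\<^bsub>T_alg X\<^esub> V) vs = T_cochain U vs - T_cochain V vs"
proof -
  interpret ring "T_alg X" by (rule T_ring)
  show ?thesis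
    using assms by (simp add: a_minus_def T_cochain_add T_cochain_minus)
qed

lemma T_cochain_finsum:
  assumes "finite A" "\<And>i. i \<in> A \<Longrightarrow> f i \<in> carrier (T_alg X)"
  shows "T_cochain (finsum (T_alg X) f A) vs = (\<Sum>i\<in>A. T_cochain (f i) vs)"
proof -
  interpret ring "T_alg X" by (rule T_ring)
  show ?thesis
    using assms by (induction A rule: finite_induct) (auto simp: T_cochain_add Pi_def intro!: finsum_closed)
qed

text \<open>The homogeneous components of a combination of words.\<close>

definition word_component :: "nat \<Rightarrow> ('a list \<Rightarrow>\<^sub>0 int) \<Rightarrow> ('a list \<Rightarrow>\<^sub>0 int)" where
  "word_component n = frag_extend (\<lambda>w. if length w = n then frag_of w else 0)"

lemma keys_word_component:
  "Poly_Mapping.keys (word_component n f) \<subseteq> {w \<in> Poly_Mapping.keys f. length w = n}"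
  using keys_frag_extend[of "\<lambda>w. if length w = n then frag_of w else 0" f]
  by (auto simp: word_component_def split: if_splits)

lemma cochain_word_component:
  "cochain (word_component n f) vs = (if length vs = n then cochain f vs else 0)"
  using subset_UNIV[of "Poly_Mapping.keys f"]
  by (induction f rule: frag_induction)
    (auto simp: word_component_def frag_extend_diff cochain_diff word_eval_length)

lemma T_grade_eq:
  "T_grade X n = tensor_class (m_group X) `
     {f. Poly_Mapping.keys f \<subseteq> lists (m_ideal X) \<and> Poly_Mapping.keys f \<subseteq> {w. length w = n}}"
proof -
  have "{c. Poly_Mapping.keys c \<subseteq> {w \<in> lists (m_ideal X). length w = n}} =
      {f :: 'a qpoly list \<Rightarrow>\<^sub>0 int.
        Poly_Mapping.keys f \<subseteq> lists (m_ideal X) \<and> Poly_Mapping.keys f \<subseteq> {w. length w = n}}"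
    by blast
  then show ?thesis
    by (simp only: T_grade_def tensor_grade_def m_group_simps)
qed

lemma T_grade_component:
  assumes "Poly_Mapping.keys f \<subseteq> lists (m_ideal X)"
  shows "Poly_Mapping.keys (word_component n f) \<subseteq> lists (m_ideal X)"
    "tensor_class (m_group X) (word_component n f) \<in> T_grade X n"
proof -
  show k: "Poly_Mapping.keys (word_component n f) \<subseteq> lists (m_ideal X)"
    using keys_word_component[of n f] assms by blast
  show "tensor_class (m_group X) (word_component n f) \<in> T_grade X n"
    unfolding T_grade_eq using k keys_word_component[of n f] by blast
qed

text \<open>The homogeneous elements of degree \<open>n\<close> are those whose cochains are functions of \<open>n\<close> points.\<close>

lemma T_grade_iff:
  "U \<in> T_grade X n \<longleftrightarrow> U \<in> carrier (T_alg X) \<and> (\<forall>vs. length vs \<noteq> n \<longrightarrow> T_cochain U vs = 0)"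
proof (intro iffI conjI allI impI; (elim conjE)?)
  assume "U \<in> T_grade X n"
  then obtain f where f: "Poly_Mapping.keys f \<subseteq> lists (m_ideal X)"
      "Poly_Mapping.keys f \<subseteq> {w. length w = n}" "U = tensor_class (m_group X) f"
    by (auto simp: T_grade_eq simp del: in_lists_conv_set)
  then show "U \<in> carrier (T_alg X)"
    by (simp add: T_carrierI del: in_lists_conv_set)
  show "T_cochain U vs = 0" if "length vs \<noteq> n" for vs
    using f that by (simp add: T_cochain_class cochain_length del: in_lists_conv_set)
next
  assume U: "U \<in> carrier (T_alg X)" "\<forall>vs. length vs \<noteq> n \<longrightarrow> T_cochain U vs = 0"
  then obtain f where f: "Poly_Mapping.keys f \<subseteq> lists (m_ideal X)" "U = tensor_class (m_group X) f"
      "T_cochain U = cochain f"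
    by (elim T_carrierE)
  have "U = tensor_class (m_group X) (word_component n f)"
    unfolding f(2) tensor_class_eq_iff[OF f(1) T_grade_component(1)[OF f(1)]]
    using U(2) f(3) by (auto simp: fun_eq_iff cochain_word_component)
  then show "U \<in> T_grade X n"
    using T_grade_component(2)[OF f(1)] by simp
qed

text \<open>An operation on words induces one on classes as soon as it comes from a bilinear operation on
  cochains: then the class of a result only depends on the cochains of the representatives.
  Compatibility with differences is all of bilinearity that is needed.\<close>

lemma tensor_lift_class:
  fixes h :: "'x qpoly list \<Rightarrow> 'x qpoly list \<Rightarrow> ('x qpoly list \<Rightarrow>\<^sub>0 int)"
    and H :: "(('x \<Rightarrow> int) list \<Rightarrow> rat) \<Rightarrow> (('x \<Rightarrow> int) list \<Rightarrow> rat) \<Rightarrow> ('x \<Rightarrow> int) list \<Rightarrow> rat"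
  assumes keys: "\<And>u w. u \<in> lists (m_ideal X) \<Longrightarrow> w \<in> lists (m_ideal X) \<Longrightarrow>
      Poly_Mapping.keys (h u w) \<subseteq> lists (m_ideal X)"
    and word: "\<And>u w vs. cochain (h u w) vs = H (word_eval u) (word_eval w) vs"
    and diff_left: "\<And>F F' G vs. H (\<lambda>vs. F vs - F' vs) G vs = H F G vs - H F' G vs"
    and diff_right: "\<And>F G G' vs. H F (\<lambda>vs. G vs - G' vs) vs = H F G vs - H F G' vs"
    and U: "U \<in> carrier (T_alg X)" and V: "V \<in> carrier (T_alg X)"
  shows "tensor_lift (m_group X) h U V \<in> carrier (T_alg X)"
    "T_cochain (tensor_lift (m_group X) h U V) vs = H (T_cochain U) (T_cochain V) vs"
proof -
  let ?E = "\<lambda>f g. frag_extend (\<lambda>u. frag_extend (h u) g) f"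
  have H0: "H (\<lambda>_. 0) G vs = 0" "H F (\<lambda>_. 0) vs = 0" for F G vs
    using diff_left[of "\<lambda>_. 0" "\<lambda>_. 0" G vs] diff_right[of F "\<lambda>_. 0" "\<lambda>_. 0" vs] by simp_all
  have co: "cochain 0 = (\<lambda>_ :: ('x \<Rightarrow> int) list. 0)" "cochain (frag_of w) = word_eval w"
      "cochain (a - b) = (\<lambda>vs. cochain a vs - cochain b vs)" for w and a b :: "'x qpoly list \<Rightarrow>\<^sub>0 int"
    by (auto simp: cochain_diff)
  have E1: "cochain (frag_extend (h u) g) vs = H (word_eval u) (cochain g) vs" for u g vs
    using subset_UNIV[of "Poly_Mapping.keys g"]
    by (induction g rule: frag_induction) (simp_all add: frag_extend_diff co H0 diff_right word)
  have E: "cochain (?E f g) vs = H (cochain f) (cochain g) vs" for f g vs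
    using subset_UNIV[of "Poly_Mapping.keys f"]
    by (induction f rule: frag_induction) (simp_all add: frag_extend_diff co H0 diff_left E1)
  have keysE: "Poly_Mapping.keys (?E f g) \<subseteq> lists (m_ideal X)"
    if "Poly_Mapping.keys f \<subseteq> lists (m_ideal X)" "Poly_Mapping.keys g \<subseteq> lists (m_ideal X)" for f g
    by (intro order_trans[OF keys_frag_extend] UN_least keys) (use that in blast)+
  obtain f where f: "Poly_Mapping.keys f \<subseteq> lists (m_ideal X)" "U = tensor_class (m_group X) f"
      "T_cochain U = cochain f"
    using U by (rule T_carrierE)
  obtain g where g: "Poly_Mapping.keys g \<subseteq> lists (m_ideal X)" "V = tensor_class (m_group X) g"
      "T_cochain V = cochain g"
    using V by (rule T_carrierE)
  have "tensor_class (m_group X) (?E f' g') = tensor_class (m_group X) (?E f g)"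
    if "f' \<in> U" "g' \<in> V" for f' g'
  proof -
    note f' = tensor_class_member[OF f(1) that(1)[unfolded f(2)]]
    note g' = tensor_class_member[OF g(1) that(2)[unfolded g(2)]]
    show ?thesis
      by (simp add: tensor_class_eq_iff keysE f(1) g(1) f'(1) g'(1) fun_eq_iff E f'(2) g'(2) del: in_lists_conv_set)
  qed
  moreover have "f \<in> U" "g \<in> V"
    by (simp_all add: f(2) g(2) tensor_class_self)
  ultimately have lift: "tensor_lift (m_group X) h U V = tensor_class (m_group X) (?E f g)"
    unfolding tensor_lift_def by blast
  show "tensor_lift (m_group X) h U V \<in> carrier (T_alg X)"
    unfolding lift by (intro T_carrierI keysE f g)
  show "T_cochain (tensor_lift (m_group X) h U V) vs = H (T_cochain U) (T_cochain V) vs"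
    unfolding lift T_cochain_class[OF keysE[OF f(1) g(1)]] E f(3) g(3) ..
qed

text \<open>The cup-one products and the map \<open>\<circ>\<close> on cochains. They are zero outside the degrees where the
  products are defined.\<close>

fun cup1_cochain :: "('v list \<Rightarrow> rat) \<Rightarrow> ('v list \<Rightarrow> rat) \<Rightarrow> 'v list \<Rightarrow> rat" where
  "cup1_cochain F G [v] = F [v] * G [v]"
| "cup1_cochain F G [v, w] = F [v, w] * (G [v] + G [w])"
| "cup1_cochain _ _ _ = 0"

fun circ_cochain :: "('v list \<Rightarrow> rat) \<Rightarrow> ('v list \<Rightarrow> rat) \<Rightarrow> 'v list \<Rightarrow> rat" where
  "circ_cochain F G [v, w] = F [v, w] * G [v, w]"
| "circ_cochain _ _ _ = 0"

lemma cochain_cup1_words: "cochain (cup1_words u w) vs = cup1_cochain (word_eval u) (word_eval w) vs"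
  by (cases "(u, w)" rule: cup1_words.cases; cases "(word_eval u, word_eval w, vs)" rule: cup1_cochain.cases)
    (auto simp: cochain_add qpoly_eval_mult algebra_simps)

lemma cochain_circ_words: "cochain (circ_words u w) vs = circ_cochain (word_eval u) (word_eval w) vs"
  by (cases "(u, w)" rule: circ_words.cases; cases "(word_eval u, word_eval w, vs)" rule: circ_cochain.cases)
    (auto simp: qpoly_eval_mult)

lemma T_cup1:
  assumes "U \<in> carrier (T_alg X)" "V \<in> carrier (T_alg X)"
  shows "T_cup1 X U V \<in> carrier (T_alg X)"
    "T_cochain (T_cup1 X U V) vs = cup1_cochain (T_cochain U) (T_cochain V) vs"
proof -
  have 1: "Poly_Mapping.keys (cup1_words u w) \<subseteq> lists (m_ideal X)"
    if "u \<in> lists (m_ideal X)" "w \<in> lists (m_ideal X)" for u w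
    using that by (cases "(u, w)" rule: cup1_words.cases)
      (simp_all add: m_ideal_mult keys_add_subset del: in_lists_conv_set)
  have 2: "cup1_cochain (\<lambda>vs. F vs - F' vs) G vs = cup1_cochain F G vs - cup1_cochain F' G vs"
    "cup1_cochain G (\<lambda>vs. F vs - F' vs) vs = cup1_cochain G F vs - cup1_cochain G F' vs"
    for F F' G and vs :: "('a \<Rightarrow> int) list"
    by (cases "(F, F', vs)" rule: cup1_cochain.cases; simp add: algebra_simps)+
  show "T_cup1 X U V \<in> carrier (T_alg X)"
    "T_cochain (T_cup1 X U V) vs = cup1_cochain (T_cochain U) (T_cochain V) vs"
    unfolding T_cup1_def
    by (rule tensor_lift_class[OF 1 cochain_cup1_words 2 assms]; assumption)+
qed

lemma T_circ:
  assumes "U \<in> carrier (T_alg X)" "V \<in> carrier (T_alg X)"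
  shows "T_circ X U V \<in> carrier (T_alg X)"
    "T_cochain (T_circ X U V) vs = circ_cochain (T_cochain U) (T_cochain V) vs"
proof -
  have 1: "Poly_Mapping.keys (circ_words u w) \<subseteq> lists (m_ideal X)"
    if "u \<in> lists (m_ideal X)" "w \<in> lists (m_ideal X)" for u w
    using that by (cases "(u, w)" rule: circ_words.cases) (auto simp: m_ideal_mult)
  have 2: "circ_cochain (\<lambda>vs. F vs - F' vs) G vs = circ_cochain F G vs - circ_cochain F' G vs"
    "circ_cochain G (\<lambda>vs. F vs - F' vs) vs = circ_cochain G F vs - circ_cochain G F' vs"
    for F F' G and vs :: "('a \<Rightarrow> int) list"
    by (cases "(F, F', vs)" rule: circ_cochain.cases; simp add: algebra_simps)+
  show "T_circ X U V \<in> carrier (T_alg X)"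
    "T_cochain (T_circ X U V) vs = circ_cochain (T_cochain U) (T_cochain V) vs"
    unfolding T_circ_def
    by (rule tensor_lift_class[OF 1 cochain_circ_words 2 assms]; assumption)+
qed

text \<open>The differential of the tensor algebra: the element whose cochain is the coboundary. It exists
  by \<open>coboundary_cochain\<close> and is unique by \<open>T_cochain_inject\<close>.\<close>

definition T_diff :: "'x set \<Rightarrow> 'x free_binomial \<Rightarrow> 'x free_binomial" where
  "T_diff X U = (THE V. V \<in> carrier (T_alg X) \<and> T_cochain V = coboundary (T_cochain U))"

lemma T_diff:
  assumes "U \<in> carrier (T_alg X)"
  shows "T_diff X U \<in> carrier (T_alg X)" "T_cochain (T_diff X U) = coboundary (T_cochain U)"
proof -
  obtain f where f: "Poly_Mapping.keys f \<subseteq> lists (m_ideal X)" "T_cochain U = cochain f"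
    using assms by (rule T_carrierE)
  obtain g where g: "Poly_Mapping.keys g \<subseteq> lists (m_ideal X)" "cochain g = coboundary (cochain f)"
    using coboundary_cochain[OF f(1)] by blast
  have "\<exists>!V. V \<in> carrier (T_alg X) \<and> T_cochain V = coboundary (T_cochain U)"
  proof (rule ex1I)
    show "tensor_class (m_group X) g \<in> carrier (T_alg X) \<and>
        T_cochain (tensor_class (m_group X) g) = coboundary (T_cochain U)"
      by (simp add: T_carrierI T_cochain_class g f(2) del: in_lists_conv_set)
    then show "V = tensor_class (m_group X) g"
      if "V \<in> carrier (T_alg X) \<and> T_cochain V = coboundary (T_cochain U)" for V
      using that by (intro T_cochain_inject[of V X]) auto
  qed
  from theI'[OF this, folded T_diff_def]
  show "T_diff X U \<in> carrier (T_alg X)" "T_cochain (T_diff X U) = coboundary (T_cochain U)"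
    by auto
qed

section \<open>Recognising binomial rings\<close>

lemma rat_group_simps [simp]:
  "carrier rat_group = UNIV" "monoid.mult rat_group = (+)" "\<one>\<^bsub>rat_group\<^esub> = 0"
  by (simp_all add: rat_group_def)

text \<open>A natural factor can be moved across the tensor product with the rationals.\<close>

lemma pure_tensor_multiple:
  fixes n :: nat
  assumes "abelian_group B" "c \<in> carrier B"
  shows "pure_tensor (add_monoid B) rat_group ([n] \<cdot>\<^bsub>B\<^esub> c) y =
    pure_tensor (add_monoid B) rat_group c (of_nat n * y)"
proof -
  interpret abelian_group B by fact
  define F where "F = free_Abelian_group (carrier B \<times> (UNIV :: rat set))"
  define K where "K = tensor_kernel (add_monoid B) rat_group"
  have sub: "tensor_relations (add_monoid B) rat_group \<subseteq> carrier F"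
  proof
    fix f assume "f \<in> tensor_relations (add_monoid B) rat_group"
    then show "f \<in> carrier F"
      unfolding tensor_relations_def F_def
      by (elim UnE CollectE exE conjE) (simp_all add: keys_diff_subset)
  qed
  interpret F: group F
    by (simp add: F_def)
  have K: "subgroup K F"
    unfolding K_def tensor_kernel_def using F.generate_is_subgroup[OF sub] by (simp add: F_def)
  have K_add: "a + b \<in> K" if "a \<in> K" "b \<in> K" for a b
    using subgroup.m_closed[OF K that] by (simp add: F_def)
  have K_minus: "- a \<in> K" if "a \<in> K" for a
    using subgroup.m_inv_closed[OF K that] subgroup.mem_carrier[OF K that] by (simp add: F_def)
  have K_diff: "a - b \<in> K" if "a \<in> K" "b \<in> K" for a b
    using K_add[OF that(1) K_minus[OF that(2)]] by simp
  have rel_left: "frag_of (x \<oplus>\<^bsub>B\<^esub> x', z) - frag_of (x, z) - frag_of (x', z) \<in> K"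
    if "x \<in> carrier B" "x' \<in> carrier B" for x x' z
    unfolding K_def tensor_kernel_def tensor_relations_def
    by (rule generate.incl, intro UnI1 CollectI, rule exI[of _ x], rule exI[of _ x'], rule exI[of _ z]) (simp add: that)
  have rel_right: "frag_of (x, z + z') - frag_of (x, z) - frag_of (x, z') \<in> K"
    if "x \<in> carrier B" for x z z'
    unfolding K_def tensor_kernel_def tensor_relations_def
    by (rule generate.incl, intro UnI2 CollectI, rule exI[of _ x], rule exI[of _ z], rule exI[of _ z']) (simp add: that)
  have "frag_of ([n] \<cdot>\<^bsub>B\<^esub> c, y) - frag_of (c, of_nat n * y) \<in> K"
  proof (induction n)
    case 0
    have "frag_of (\<zero>\<^bsub>B\<^esub>, y) \<in> K"
      using K_minus[OF rel_left[of "\<zero>\<^bsub>B\<^esub>" "\<zero>\<^bsub>B\<^esub>" y]] by simp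
    moreover have "frag_of (c, 0) \<in> K"
      using K_minus[OF rel_right[OF assms(2), of 0 0]] by simp
    ultimately show ?case
      using K_diff by (simp add: add.nat_pow_0)
  next
    case (Suc n)
    have nc: "[n] \<cdot>\<^bsub>B\<^esub> c \<in> carrier B"
      using assms(2) by simp
    have "frag_of ([n] \<cdot>\<^bsub>B\<^esub> c \<oplus>\<^bsub>B\<^esub> c, y) - frag_of ([n] \<cdot>\<^bsub>B\<^esub> c, y) - frag_of (c, y) +
        (frag_of ([n] \<cdot>\<^bsub>B\<^esub> c, y) - frag_of (c, of_nat n * y)) -
        (frag_of (c, of_nat n * y + y) - frag_of (c, of_nat n * y) - frag_of (c, y)) \<in> K"
      by (intro K_add K_diff rel_left rel_right Suc.IH nc assms(2))
    then show ?case
      using assms(2) by (simp add: add.nat_pow_Suc distrib_right add.commute)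
  qed
  then have ab: "frag_of ([n] \<cdot>\<^bsub>B\<^esub> c, y) - frag_of (c, of_nat n * y) \<in> K" (is "?a - ?b \<in> K") .
  have "K #>\<^bsub>F\<^esub> ?a = K #>\<^bsub>F\<^esub> ?b"
  proof -
    have "h + ?a \<in> K #>\<^bsub>F\<^esub> ?b" if "h \<in> K" for h
      using K_add[OF that ab] by (auto simp: r_coset_def F_def intro!: bexI[of _ "h + (?a - ?b)"])
    moreover have "h + ?b \<in> K #>\<^bsub>F\<^esub> ?a" if "h \<in> K" for h
      using K_diff[OF that ab] by (auto simp: r_coset_def F_def intro!: bexI[of _ "h - (?a - ?b)"])
    ultimately show ?thesis
      by (auto simp: r_coset_def F_def)
  qed
  then show ?thesis
    by (simp add: pure_tensor_def F_def K_def)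
qed

text \<open>A commutative ring that embeds into a ring of rational-valued functions is binomial if its
  image is closed under binomial coefficients.\<close>

lemma binomial_ring_functions:
  fixes \<Theta> :: "'b \<Rightarrow> 'v \<Rightarrow> rat"
  assumes B: "cring B"
    and inj: "\<And>x y. x \<in> carrier B \<Longrightarrow> y \<in> carrier B \<Longrightarrow> (\<And>v. \<Theta> x v = \<Theta> y v) \<Longrightarrow> x = y"
    and add: "\<And>x y v. x \<in> carrier B \<Longrightarrow> y \<in> carrier B \<Longrightarrow> \<Theta> (x \<oplus>\<^bsub>B\<^esub> y) v = \<Theta> x v + \<Theta> y v"
    and mult: "\<And>x y v. x \<in> carrier B \<Longrightarrow> y \<in> carrier B \<Longrightarrow> \<Theta> (x \<otimes>\<^bsub>B\<^esub> y) v = \<Theta> x v * \<Theta> y v"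
    and one: "\<And>v. \<Theta> \<one>\<^bsub>B\<^esub> v = 1"
    and binom: "\<And>x n. x \<in> carrier B \<Longrightarrow> \<exists>c\<in>carrier B. \<forall>v. \<Theta> c v = \<Theta> x v gchoose n"
  shows "binomial_ring B"
proof -
  interpret cring B by fact
  have zero: "\<Theta> \<zero>\<^bsub>B\<^esub> v = 0" for v
    using add[of "\<zero>\<^bsub>B\<^esub>" "\<zero>\<^bsub>B\<^esub>" v] by simp
  have minus: "\<Theta> (\<ominus>\<^bsub>B\<^esub> x) v = - \<Theta> x v" if "x \<in> carrier B" for x v
    using add[of x "\<ominus>\<^bsub>B\<^esub> x" v] that by (simp add: r_neg zero)
  have multiple: "\<Theta> ([n] \<cdot>\<^bsub>B\<^esub> x) v = of_nat n * \<Theta> x v" if "x \<in> carrier B" for x v and n :: nat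
    by (induction n) (use that in \<open>auto simp: zero add algebra_simps\<close>)
  have falling: "falling_factorial B x n \<in> carrier B \<and>
      \<Theta> (falling_factorial B x n) v = (\<Prod>i<n. \<Theta> x v - of_nat i)" if x: "x \<in> carrier B" for x v n
  proof (induction n)
    case 0
    then show ?case
      by (simp add: falling_factorial_def one)
  next
    case (Suc n)
    have "falling_factorial B x (Suc n) =
        (x \<ominus>\<^bsub>B\<^esub> [n] \<cdot>\<^bsub>B\<^esub> \<one>\<^bsub>B\<^esub>) \<otimes>\<^bsub>B\<^esub> falling_factorial B x n"
      unfolding falling_factorial_def lessThan_Suc using x by (subst finprod_insert) auto
    with Suc x show ?case
      by (simp add: mult add minus multiple one a_minus_def mult.commute)
  qed
  show ?thesis
    unfolding binomial_ring_def
  proof (intro conjI B ballI allI impI)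
    fix b and n :: nat
    assume b: "b \<in> carrier B" and n: "n > 0" and nb: "[n] \<cdot>\<^bsub>B\<^esub> b = \<zero>\<^bsub>B\<^esub>"
    have "\<Theta> b v = 0" for v
      using multiple[OF b, of n v] n by (simp add: nb zero)
    then show "b = \<zero>\<^bsub>B\<^esub>"
      using b by (intro inj) (auto simp: zero)
  next
    fix b and n :: nat
    assume b: "b \<in> carrier B"
    obtain c where c: "c \<in> carrier B" "\<And>v. \<Theta> c v = \<Theta> b v gchoose n"
      using binom[OF b] by blast
    have "falling_factorial B b n = [(fact n :: nat)] \<cdot>\<^bsub>B\<^esub> c"
    proof (rule inj)
      fix v
      show "\<Theta> (falling_factorial B b n) v = \<Theta> ([(fact n :: nat)] \<cdot>\<^bsub>B\<^esub> c) v"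
        using falling[OF b, of n v] gbinomial_mult_fact[of n "\<Theta> b v"]
        by (simp add: multiple[OF c(1)] c(2) atLeast0LessThan)
    qed (use falling[OF b] c in auto)
    then have "pure_tensor (add_monoid B) rat_group (falling_factorial B b n) (1 / fact n) =
        pure_tensor (add_monoid B) rat_group c 1"
      using pure_tensor_multiple[OF abelian_group_axioms c(1), of "fact n" "1 / fact n"] by simp
    then show "pure_tensor (add_monoid B) rat_group (falling_factorial B b n) (1 / fact n)
        \<in> (\<lambda>c. pure_tensor (add_monoid B) rat_group c 1) ` carrier B"
      using c(1) by blast
  qed
qed

text \<open>The ring axioms are inherited from the ring of functions as well.\<close>

lemma cring_functions:
  fixes \<Theta> :: "'b \<Rightarrow> 'v \<Rightarrow> rat"
  assumes inj: "\<And>x y. x \<in> carrier B \<Longrightarrow> y \<in> carrier B \<Longrightarrow> (\<And>v. \<Theta> x v = \<Theta> y v) \<Longrightarrow> x = y"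
    and closed: "\<And>x y. x \<in> carrier B \<Longrightarrow> y \<in> carrier B \<Longrightarrow> x \<oplus>\<^bsub>B\<^esub> y \<in> carrier B"
      "\<And>x y. x \<in> carrier B \<Longrightarrow> y \<in> carrier B \<Longrightarrow> x \<otimes>\<^bsub>B\<^esub> y \<in> carrier B"
      "\<zero>\<^bsub>B\<^esub> \<in> carrier B" "\<one>\<^bsub>B\<^esub> \<in> carrier B"
    and add: "\<And>x y v. x \<in> carrier B \<Longrightarrow> y \<in> carrier B \<Longrightarrow> \<Theta> (x \<oplus>\<^bsub>B\<^esub> y) v = \<Theta> x v + \<Theta> y v"
    and mult: "\<And>x y v. x \<in> carrier B \<Longrightarrow> y \<in> carrier B \<Longrightarrow> \<Theta> (x \<otimes>\<^bsub>B\<^esub> y) v = \<Theta> x v * \<Theta> y v"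
    and zero: "\<And>v. \<Theta> \<zero>\<^bsub>B\<^esub> v = 0" and one: "\<And>v. \<Theta> \<one>\<^bsub>B\<^esub> v = 1"
    and minus: "\<And>x. x \<in> carrier B \<Longrightarrow> \<exists>y\<in>carrier B. \<forall>v. \<Theta> y v = - \<Theta> x v"
  shows "cring B"
proof (rule cringI)
  show "abelian_group B"
  proof (rule abelian_groupI)
    fix x assume x: "x \<in> carrier B"
    obtain y where y: "y \<in> carrier B" "\<And>v. \<Theta> y v = - \<Theta> x v"
      using minus[OF x] by blast
    have "y \<oplus>\<^bsub>B\<^esub> x = \<zero>\<^bsub>B\<^esub>"
      by (rule inj) (simp_all add: closed add zero x y)
    with y show "\<exists>y\<in>carrier B. y \<oplus>\<^bsub>B\<^esub> x = \<zero>\<^bsub>B\<^esub>"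
      by blast
  next
    fix x y z assume "x \<in> carrier B" "y \<in> carrier B" "z \<in> carrier B"
    then show "x \<oplus>\<^bsub>B\<^esub> y \<oplus>\<^bsub>B\<^esub> z = x \<oplus>\<^bsub>B\<^esub> (y \<oplus>\<^bsub>B\<^esub> z)"
      by (intro inj) (simp_all add: closed add)
  next
    fix x y assume "x \<in> carrier B" "y \<in> carrier B"
    then show "x \<oplus>\<^bsub>B\<^esub> y = y \<oplus>\<^bsub>B\<^esub> x"
      by (intro inj) (simp_all add: closed add)
  next
    fix x assume "x \<in> carrier B"
    then show "\<zero>\<^bsub>B\<^esub> \<oplus>\<^bsub>B\<^esub> x = x"
      by (intro inj) (simp_all add: closed add zero)
  qed (simp_all add: closed)
  show "comm_monoid B"
  proof (rule comm_monoidI)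
    fix x y z assume "x \<in> carrier B" "y \<in> carrier B" "z \<in> carrier B"
    then show "x \<otimes>\<^bsub>B\<^esub> y \<otimes>\<^bsub>B\<^esub> z = x \<otimes>\<^bsub>B\<^esub> (y \<otimes>\<^bsub>B\<^esub> z)"
      by (intro inj) (simp_all add: closed mult)
  next
    fix x y assume "x \<in> carrier B" "y \<in> carrier B"
    then show "x \<otimes>\<^bsub>B\<^esub> y = y \<otimes>\<^bsub>B\<^esub> x"
      by (intro inj) (simp_all add: closed mult)
  next
    fix x assume "x \<in> carrier B"
    then show "\<one>\<^bsub>B\<^esub> \<otimes>\<^bsub>B\<^esub> x = x"
      by (intro inj) (simp_all add: closed mult one)
  qed (simp_all add: closed)
  fix x y z assume "x \<in> carrier B" "y \<in> carrier B" "z \<in> carrier B"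
  then show "(x \<oplus>\<^bsub>B\<^esub> y) \<otimes>\<^bsub>B\<^esub> z = x \<otimes>\<^bsub>B\<^esub> z \<oplus>\<^bsub>B\<^esub> y \<otimes>\<^bsub>B\<^esub> z"
    by (intro inj) (simp_all add: closed add mult distrib_right)
qed

lemma binomial_ring_int: "binomial_ring \<Z>"
proof (rule binomial_ring_functions[where \<Theta> = "\<lambda>k (_::unit). of_int k"])
  show "\<exists>c\<in>carrier \<Z>. \<forall>v::unit. of_int c = (of_int x :: rat) gchoose n" for x n
    using gbinomial_of_int_Ints[of x n] by (auto elim!: Ints_cases)
qed (auto simp: int_is_cring)

section \<open>The unitization of the degree one part\<close>

(* Otherwise the simplifier turns the degree one part T_grade X 1 into T_grade X (Suc 0). *)
declare One_nat_def [simp del]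

lemma T_grade_1_poly:
  assumes "U \<in> T_grade X 1"
  shows "\<exists>p\<in>m_ideal X. \<forall>v. T_cochain U [v] = qpoly_eval v p"
proof -
  obtain f where f: "Poly_Mapping.keys f \<subseteq> lists (m_ideal X)" "T_cochain U = cochain f"
    using assms by (auto simp: T_grade_iff elim: T_carrierE)
  have "\<exists>p\<in>m_ideal X. \<forall>v. cochain f [v] = qpoly_eval v p"
    using f(1)
  proof (induction f rule: frag_induction)
    case zero
    show ?case
      by (intro bexI[of _ 0]) (auto simp: m_ideal_0)
  next
    case (one w)
    show ?case
    proof (cases "length w = 1")
      case True
      then obtain p where "w = [p]"
        by (auto simp: length_Suc_conv One_nat_def)
      with one show ?thesis
        by (intro bexI[of _ p]) auto
    next
      case False
      then show ?thesis
        by (intro bexI[of _ 0]) (auto simp: m_ideal_0 word_eval_length)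
    qed
  next
    case (diff a b)
    then obtain p q where "p \<in> m_ideal X" "\<forall>v. cochain a [v] = qpoly_eval v p"
        "q \<in> m_ideal X" "\<forall>v. cochain b [v] = qpoly_eval v q"
      by blast
    then show ?case
      using m_ideal_add[of p X "- q"] m_ideal_uminus[of q X]
      by (intro bexI[of _ "p - q"]) (auto simp: cochain_diff qpoly_eval_diff)
  qed
  with f(2) show ?thesis
    by simp
qed

lemma T_incl:
  assumes "p \<in> m_ideal X"
  shows "T_incl X p \<in> T_grade X 1" "T_cochain (T_incl X p) = word_eval [p]"
proof -
  have keys: "Poly_Mapping.keys (frag_of [p]) \<subseteq> lists (m_ideal X)"
    using assms by simp
  show 1: "T_cochain (T_incl X p) = word_eval [p]"
    by (simp add: T_incl_def T_cochain_class[OF keys] fun_eq_iff)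
  show "T_incl X p \<in> T_grade X 1"
    unfolding T_grade_iff 1 using T_carrierI[OF keys] by (simp add: T_incl_def word_eval_length)
qed

text \<open>An element of the unitization as a function on points. Its values are those of an
  integer-valued polynomial, and this identifies the unitization with the ring of all of these: the
  integer component is the constant term.\<close>

definition unit_eval :: "int \<times> 'x free_binomial \<Rightarrow> ('x \<Rightarrow> int) \<Rightarrow> rat" where
  "unit_eval x v = of_int (fst x) + T_cochain (snd x) [v]"

abbreviation T_unit :: "'x set \<Rightarrow> (int \<times> 'x free_binomial) ring" where
  "T_unit X \<equiv> unitization \<Z> (T_alg X) (T_grade X 1) (T_cup1 X)"

lemma T_unit_simps [simp]:
  "carrier (T_unit X) = UNIV \<times> T_grade X 1"
  "(r, U) \<otimes>\<^bsub>T_unit X\<^esub> (s, V) =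
     (r * s, r \<odot>\<^bsub>T_alg X\<^esub> V \<oplus>\<^bsub>T_alg X\<^esub> s \<odot>\<^bsub>T_alg X\<^esub> U \<oplus>\<^bsub>T_alg X\<^esub> T_cup1 X U V)"
  "\<one>\<^bsub>T_unit X\<^esub> = (1, \<zero>\<^bsub>T_alg X\<^esub>)" "\<zero>\<^bsub>T_unit X\<^esub> = (0, \<zero>\<^bsub>T_alg X\<^esub>)"
  "(r, U) \<oplus>\<^bsub>T_unit X\<^esub> (s, V) = (r + s, U \<oplus>\<^bsub>T_alg X\<^esub> V)"
  by (simp_all add: unitization_def)

lemma T_grade_closed:
  "U \<in> T_grade X n \<Longrightarrow> V \<in> T_grade X n \<Longrightarrow> U \<oplus>\<^bsub>T_alg X\<^esub> V \<in> T_grade X n"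
  "U \<in> T_grade X n \<Longrightarrow> k \<odot>\<^bsub>T_alg X\<^esub> U \<in> T_grade X n"
  "\<zero>\<^bsub>T_alg X\<^esub> \<in> T_grade X n"
  "U \<in> T_grade X n \<Longrightarrow> \<ominus>\<^bsub>T_alg X\<^esub> U \<in> T_grade X n"
proof -
  interpret ring "T_alg X" by (rule T_ring)
  show "U \<in> T_grade X n \<Longrightarrow> V \<in> T_grade X n \<Longrightarrow> U \<oplus>\<^bsub>T_alg X\<^esub> V \<in> T_grade X n"
    "U \<in> T_grade X n \<Longrightarrow> k \<odot>\<^bsub>T_alg X\<^esub> U \<in> T_grade X n"
    "\<zero>\<^bsub>T_alg X\<^esub> \<in> T_grade X n"
    "U \<in> T_grade X n \<Longrightarrow> \<ominus>\<^bsub>T_alg X\<^esub> U \<in> T_grade X n"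
    by (simp_all add: T_grade_iff T_cochain_add T_smult_closed T_cochain_minus)
qed

lemma T_cup1_grade:
  assumes "p \<in> {1, 2}" "U \<in> T_grade X p" "V \<in> T_grade X 1"
  shows "T_cup1 X U V \<in> T_grade X p"
proof -
  have UV: "U \<in> carrier (T_alg X)" "V \<in> carrier (T_alg X)"
    using assms by (auto simp: T_grade_iff)
  have "cup1_cochain (T_cochain U) (T_cochain V) vs = 0" if "length vs \<noteq> p" for vs
    using that assms by (cases "(T_cochain U, T_cochain V, vs)" rule: cup1_cochain.cases)
      (auto simp: T_grade_iff)
  then show ?thesis
    by (simp add: T_grade_iff T_cup1[OF UV])
qed

lemma unit_eval_inject:
  assumes "x \<in> carrier (T_unit X)" "y \<in> carrier (T_unit X)" "\<And>v. unit_eval x v = unit_eval y v"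
  shows "x = y"
proof -
  obtain r U s V where xy: "x = (r, U)" "y = (s, V)" and UV: "U \<in> T_grade X 1" "V \<in> T_grade X 1"
    using assms(1,2) by auto
  have "T_cochain U [\<lambda>_. 0] = 0" "T_cochain V [\<lambda>_. 0] = 0"
    using T_grade_1_poly[OF UV(1)] T_grade_1_poly[OF UV(2)] by (auto simp: m_ideal_iff)
  then have rs: "r = s"
    using assms(3)[of "\<lambda>_. 0"] by (simp add: unit_eval_def xy)
  have "T_cochain U vs = T_cochain V vs" for vs
  proof (cases "length vs = 1")
    case True
    then obtain v where "vs = [v]"
      by (auto simp: length_Suc_conv One_nat_def)
    then show ?thesis
      using assms(3)[of v] rs by (simp add: unit_eval_def xy)
  qed (use UV in \<open>auto simp: T_grade_iff\<close>)
  then have "U = V"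
    using UV by (intro T_cochain_inject[where X = X]) (auto simp: T_grade_iff)
  with rs show ?thesis
    by (simp add: xy)
qed

lemma unit_eval_add:
  assumes "x \<in> carrier (T_unit X)" "y \<in> carrier (T_unit X)"
  shows "unit_eval (x \<oplus>\<^bsub>T_unit X\<^esub> y) v = unit_eval x v + unit_eval y v"
  using assms by (cases x; cases y) (auto simp: unit_eval_def T_grade_iff T_cochain_add)

lemma unit_eval_mult:
  assumes "x \<in> carrier (T_unit X)" "y \<in> carrier (T_unit X)"
  shows "unit_eval (x \<otimes>\<^bsub>T_unit X\<^esub> y) v = unit_eval x v * unit_eval y v"
proof -
  interpret ring "T_alg X" by (rule T_ring)
  obtain r U s V where xy: "x = (r, U)" "y = (s, V)" "U \<in> carrier (T_alg X)" "V \<in> carrier (T_alg X)"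
    using assms by (auto simp: T_grade_iff)
  then show ?thesis
    by (simp add: unit_eval_def T_cochain_add T_smult_closed T_cup1 algebra_simps)
qed

lemma unit_eval_poly:
  assumes "x \<in> carrier (T_unit X)"
  shows "\<exists>q\<in>Int_poly X. \<forall>v. unit_eval x v = qpoly_eval v q"
proof -
  obtain r U where x: "x = (r, U)" "U \<in> T_grade X 1"
    using assms by auto
  obtain p where p: "p \<in> m_ideal X" "\<And>v. T_cochain U [v] = qpoly_eval v p"
    using T_grade_1_poly[OF x(2)] by blast
  show ?thesis
    using p by (intro bexI[of _ "of_int r + p"])
      (auto simp: x unit_eval_def qpoly_eval_add m_ideal_iff Int_poly_add Int_poly_of_int)
qed

lemma unit_eval_surj:
  assumes "q \<in> Int_poly X"
  shows "\<exists>x\<in>carrier (T_unit X). \<forall>v. unit_eval x v = qpoly_eval v q"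
proof -
  define k where "k = \<lfloor>qpoly_eval (\<lambda>_. 0) q\<rfloor>"
  have "q - of_int k \<in> m_ideal X"
    using m_ideal_minus_const(1)[OF assms] by (simp add: k_def)
  then show ?thesis
    by (intro bexI[of _ "(k, T_incl X (q - of_int k))"]) (auto simp: T_incl unit_eval_def qpoly_eval_diff)
qed

lemma T_unit_cring: "cring (T_unit X)"
proof (rule cring_functions[where \<Theta> = unit_eval])
  interpret ring "T_alg X" by (rule T_ring)
  show "x \<otimes>\<^bsub>T_unit X\<^esub> y \<in> carrier (T_unit X)"
    if "x \<in> carrier (T_unit X)" "y \<in> carrier (T_unit X)" for x y
    using that by (cases x; cases y) (auto intro!: T_grade_closed T_cup1_grade)
  show "\<exists>y\<in>carrier (T_unit X). \<forall>v. unit_eval y v = - unit_eval x v"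
    if "x \<in> carrier (T_unit X)" for x
    using that
    by (intro bexI[of _ "(- fst x, \<ominus>\<^bsub>T_alg X\<^esub> snd x)"])
      (auto simp: unit_eval_def T_cochain_minus T_grade_iff[of _ X 1] intro!: T_grade_closed)
qed (auto simp: unit_eval_inject unit_eval_add unit_eval_mult T_grade_closed,
    auto simp: unit_eval_def)

lemma T_unit_binomial: "binomial_ring (T_unit X)"
proof (rule binomial_ring_functions[where \<Theta> = unit_eval, OF T_unit_cring])
  fix x n assume "x \<in> carrier (T_unit X)"
  then obtain q where q: "q \<in> Int_poly X" "\<forall>v. unit_eval x v = qpoly_eval v q"
    using unit_eval_poly by blast
  then show "\<exists>c\<in>carrier (T_unit X). \<forall>v. unit_eval c v = unit_eval x v gchoose n"
    using unit_eval_surj[OF Int_poly_binom_poly[OF q(1), of n]] by (simp add: binom_poly_eval)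
qed (auto simp: unit_eval_inject unit_eval_add unit_eval_mult, auto simp: unit_eval_def)

section \<open>The axioms of a binomial cup-one algebra\<close>

lemma cup_length:
  assumes "\<And>vs. length vs \<noteq> p \<Longrightarrow> F vs = 0" "\<And>vs. length vs \<noteq> q \<Longrightarrow> G vs = 0"
    "length vs \<noteq> p + q"
  shows "cup F G vs = 0"
  using assms
proof (induction vs arbitrary: F p)
  case (Cons v vs)
  show ?case
  proof (cases p)
    case 0
    then have "(\<lambda>us. F (v # us)) = (\<lambda>_. 0)"
      using Cons.prems(1) by (simp add: fun_eq_iff)
    then show ?thesis
      using Cons.prems 0 by simp
  next
    case (Suc m)
    then have "cup (\<lambda>us. F (v # us)) G vs = 0"
      using Cons.prems by (intro Cons.IH[of m]) auto
    then show ?thesis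
      using Cons.prems(1)[of "[]"] Suc by simp
  qed
qed auto

lemma T_module: "Module.module \<Z> (T_alg X)"
proof -
  interpret ring "T_alg X" by (rule T_ring)
  show ?thesis
    by (rule moduleI[OF int_is_cring is_abelian_group];
      (intro T_cochain_inject[where X = X])?; simp add: T_smult_closed T_cochain_add algebra_simps)
qed

lemma T_graded_algebra: "graded_algebra \<Z> (T_alg X) (T_grade X)"
proof -
  interpret ring "T_alg X" by (rule T_ring)
  interpret M: Module.module \<Z> "T_alg X" by (rule T_module)
  have scale: "T_cochain (r \<odot>\<^bsub>T_alg X\<^esub> a) = (\<lambda>vs. of_int r * T_cochain a vs)"
    if "a \<in> carrier (T_alg X)" for r a
    using that by (simp add: T_smult_closed fun_eq_iff)
  show ?thesis
  proof (intro graded_algebra.intro T_module T_ring graded_algebra_axioms.intro)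
    fix r a b assume "a \<in> carrier (T_alg X)" "b \<in> carrier (T_alg X)"
    then show "r \<odot>\<^bsub>T_alg X\<^esub> (a \<otimes>\<^bsub>T_alg X\<^esub> b) = (r \<odot>\<^bsub>T_alg X\<^esub> a) \<otimes>\<^bsub>T_alg X\<^esub> b"
      "r \<odot>\<^bsub>T_alg X\<^esub> (a \<otimes>\<^bsub>T_alg X\<^esub> b) = a \<otimes>\<^bsub>T_alg X\<^esub> (r \<odot>\<^bsub>T_alg X\<^esub> b)"
      by (intro T_cochain_inject[where X = X];
        simp add: T_smult_closed T_cochain_mult scale cup_scale_left cup_scale_right)+
  next
    show "inj_on (\<lambda>r. r \<odot>\<^bsub>T_alg X\<^esub> \<one>\<^bsub>T_alg X\<^esub>) (carrier \<Z>)"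
    proof (rule inj_onI)
      fix r s assume "r \<odot>\<^bsub>T_alg X\<^esub> \<one>\<^bsub>T_alg X\<^esub> = s \<odot>\<^bsub>T_alg X\<^esub> \<one>\<^bsub>T_alg X\<^esub>"
      then have "T_cochain (r \<odot>\<^bsub>T_alg X\<^esub> \<one>\<^bsub>T_alg X\<^esub>) [] = T_cochain (s \<odot>\<^bsub>T_alg X\<^esub> \<one>\<^bsub>T_alg X\<^esub>) []"
        by simp
      then show "r = s"
        by (simp add: T_smult_closed T_cochain_one)
    qed
  next
    fix i
    show "Module.submodule (T_grade X i) \<Z> (T_alg X)"
      by (rule M.submoduleI) (auto simp: T_grade_closed, auto simp: T_grade_iff)
  next
    fix a assume a: "a \<in> carrier (T_alg X)"
    obtain f where f: "Poly_Mapping.keys f \<subseteq> lists (m_ideal X)" "a = tensor_class (m_group X) f"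
        "T_cochain a = cochain f"
      using a by (rule T_carrierE)
    define c where "c i = tensor_class (m_group X) (word_component i f)" for i
    have c_grade: "c i \<in> T_grade X i" for i
      unfolding c_def by (rule T_grade_component(2)[OF f(1)])
    then have c_carrier: "c i \<in> carrier (T_alg X)" for i
      by (simp add: T_grade_iff)
    have c_cochain: "T_cochain (c i) vs = (if length vs = i then T_cochain a vs else 0)" for i vs
      unfolding c_def
      by (simp only: T_cochain_class[OF T_grade_component(1)[OF f(1)]] cochain_word_component f(3))
    show "\<exists>!f. (\<forall>i. f i \<in> T_grade X i) \<and> finite {i. f i \<noteq> \<zero>\<^bsub>T_alg X\<^esub>} \<and>
        a = finsum (T_alg X) f {i. f i \<noteq> \<zero>\<^bsub>T_alg X\<^esub>}"
    proof (rule ex1I)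
      have "c i = \<zero>\<^bsub>T_alg X\<^esub>" if "i \<notin> length ` Poly_Mapping.keys f" for i
      proof -
        have "word_component i f = 0"
          using that by (auto simp: word_component_def intro!: frag_extend_eq_0)
        then show ?thesis
          by (simp add: c_def T_zero)
      qed
      then have "{i. c i \<noteq> \<zero>\<^bsub>T_alg X\<^esub>} \<subseteq> length ` Poly_Mapping.keys f"
        by blast
      then have fin: "finite {i. c i \<noteq> \<zero>\<^bsub>T_alg X\<^esub>}"
        by (rule finite_subset) simp
      have "a = finsum (T_alg X) c {i. c i \<noteq> \<zero>\<^bsub>T_alg X\<^esub>}"
      proof (rule T_cochain_inject[where X = X])
        fix vs
        have "T_cochain a vs = 0" if "c (length vs) = \<zero>\<^bsub>T_alg X\<^esub>"
          using c_cochain[of "length vs" vs] that by simp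
        then show "T_cochain a vs = T_cochain (finsum (T_alg X) c {i. c i \<noteq> \<zero>\<^bsub>T_alg X\<^esub>}) vs"
          using fin by (auto simp: T_cochain_finsum c_carrier c_cochain)
      qed (use a c_carrier in auto)
      with c_grade fin show "(\<forall>i. c i \<in> T_grade X i) \<and> finite {i. c i \<noteq> \<zero>\<^bsub>T_alg X\<^esub>} \<and>
          a = finsum (T_alg X) c {i. c i \<noteq> \<zero>\<^bsub>T_alg X\<^esub>}"
        by blast
      fix g assume g: "(\<forall>i. g i \<in> T_grade X i) \<and> finite {i. g i \<noteq> \<zero>\<^bsub>T_alg X\<^esub>} \<and>
          a = finsum (T_alg X) g {i. g i \<noteq> \<zero>\<^bsub>T_alg X\<^esub>}"
      have g_carrier: "g i \<in> carrier (T_alg X)" for i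
        using g by (auto simp: T_grade_iff)
      have ag: "T_cochain a vs = T_cochain (g (length vs)) vs" for vs
      proof -
        let ?S = "{i. g i \<noteq> \<zero>\<^bsub>T_alg X\<^esub>}"
        have fin: "finite ?S" and a: "a = finsum (T_alg X) g ?S"
          using g by blast+
        have "T_cochain a vs = (\<Sum>i\<in>?S. T_cochain (g i) vs)"
          by (subst a) (rule T_cochain_finsum[OF fin g_carrier])
        also have "\<dots> = (\<Sum>i\<in>?S. if length vs = i then T_cochain (g (length vs)) vs else 0)"
          using g by (intro sum.cong) (auto simp: T_grade_iff)
        also have "\<dots> = (if length vs \<in> ?S then T_cochain (g (length vs)) vs else 0)"
          by (rule sum.delta'[OF fin])
        also have "\<dots> = T_cochain (g (length vs)) vs"
          by (cases "g (length vs) = \<zero>\<^bsub>T_alg X\<^esub>") simp_all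
        finally show ?thesis .
      qed
      show "g = c"
      proof (intro ext T_cochain_inject[where X = X, OF g_carrier c_carrier])
        fix i vs
        show "T_cochain (g i) vs = T_cochain (c i) vs"
          using ag[of vs] g by (auto simp: c_cochain T_grade_iff)
      qed
    qed
  next
    show "\<one>\<^bsub>T_alg X\<^esub> \<in> T_grade X 0"
      by (simp add: T_grade_iff T_cochain_one word_eval_length)
  next
    fix p q a b assume "a \<in> T_grade X p" "b \<in> T_grade X q"
    then show "a \<otimes>\<^bsub>T_alg X\<^esub> b \<in> T_grade X (p + q)"
      by (auto simp: T_grade_iff T_cochain_mult intro: cup_length)
  qed
qed

text \<open>Degree two is spanned by products of elements of degree one. So \<open>D2\<close> is everything in
  degree two.\<close>

lemma T_D2: "graded_algebra.D2 \<Z> (T_alg X) (T_grade X) = T_grade X 2"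
proof -
  interpret graded_algebra \<Z> "T_alg X" "T_grade X" by (rule T_graded_algebra)
  let ?S = "{a \<otimes>\<^bsub>T_alg X\<^esub> b | a b. a \<in> T_grade X 1 \<and> b \<in> T_grade X 1}"
  have "?S \<subseteq> T_grade X 2"
    using gr_mult[of _ 1 _ 1] by auto
  moreover have "T_grade X 2 \<subseteq> N" if N: "?S \<subseteq> N" "Module.submodule N \<Z> (T_alg X)" for N
  proof
    note N_closed = submoduleE[OF N(2)]
    fix U assume "U \<in> T_grade X 2"
    then obtain f where f: "Poly_Mapping.keys f \<subseteq> lists (m_ideal X)"
        "Poly_Mapping.keys f \<subseteq> {w. length w = 2}" "U = tensor_class (m_group X) f"
      by (auto simp: T_grade_eq simp del: in_lists_conv_set)
    then have "Poly_Mapping.keys f \<subseteq> {w \<in> lists (m_ideal X). length w = 2}"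
      by blast
    then have "Poly_Mapping.keys f \<subseteq> lists (m_ideal X) \<and> tensor_class (m_group X) f \<in> N"
    proof (induction f rule: frag_induction)
      case zero
      show ?case
        using subgroup.one_closed[OF submodule.axioms(1)[OF N(2)]] by (simp add: T_zero)
    next
      case (one w)
      then obtain p q where w: "w = [p, q]" "p \<in> m_ideal X" "q \<in> m_ideal X"
        by (auto simp: numeral_2_eq_2 length_Suc_conv)
      then have "tensor_class (m_group X) (frag_of w) = T_incl X p \<otimes>\<^bsub>T_alg X\<^esub> T_incl X q"
        by (simp add: T_incl_def T_mult word_mult_of)
      then have "tensor_class (m_group X) (frag_of w) \<in> ?S"
        using T_incl(1)[OF w(2)] T_incl(1)[OF w(3)] by blast
      then show ?case
        using N(1) w by auto
    next
      case (diff a b)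
      have b: "Poly_Mapping.keys (frag_cmul (- 1) b) \<subseteq> lists (m_ideal X)"
        using diff by simp
      have "tensor_class (m_group X) a \<oplus>\<^bsub>T_alg X\<^esub> (- 1) \<odot>\<^bsub>T_alg X\<^esub> tensor_class (m_group X) b \<in> N"
        using diff by (intro N_closed) auto
      then have "tensor_class (m_group X) (a - b) \<in> N"
        using diff b by (simp add: T_smult T_add del: in_lists_conv_set)
      then show ?case
        using diff keys_diff_subset by blast
    qed
    then show "U \<in> N"
      by (simp add: f(3))
  qed
  ultimately show ?thesis
    unfolding D2_def by (intro hull_unique gr_submodule) auto
qed

lemma T_sign:
  assumes "a \<in> carrier (T_alg X)"
  shows "((\<ominus>\<^bsub>T_alg X\<^esub> \<one>\<^bsub>T_alg X\<^esub>) [^]\<^bsub>T_alg X\<^esub> (p::nat)) \<otimes>\<^bsub>T_alg X\<^esub> a \<in> carrier (T_alg X)"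
    "T_cochain (((\<ominus>\<^bsub>T_alg X\<^esub> \<one>\<^bsub>T_alg X\<^esub>) [^]\<^bsub>T_alg X\<^esub> (p::nat)) \<otimes>\<^bsub>T_alg X\<^esub> a) vs = (- 1) ^ p * T_cochain a vs"
proof -
  interpret ring "T_alg X" by (rule T_ring)
  show "((\<ominus>\<^bsub>T_alg X\<^esub> \<one>\<^bsub>T_alg X\<^esub>) [^]\<^bsub>T_alg X\<^esub> (p::nat)) \<otimes>\<^bsub>T_alg X\<^esub> a \<in> carrier (T_alg X)"
    using assms by simp
  have "T_cochain (((\<ominus>\<^bsub>T_alg X\<^esub> \<one>\<^bsub>T_alg X\<^esub>) [^]\<^bsub>T_alg X\<^esub> p) \<otimes>\<^bsub>T_alg X\<^esub> b) vs = (- 1) ^ p * T_cochain b vs"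
    if "b \<in> carrier (T_alg X)" for b
    using that
  proof (induction p arbitrary: b)
    case (Suc p)
    then show ?case
      by (simp add: m_assoc l_minus T_cochain_minus)
  qed simp
  with assms show "T_cochain (((\<ominus>\<^bsub>T_alg X\<^esub> \<one>\<^bsub>T_alg X\<^esub>) [^]\<^bsub>T_alg X\<^esub> p) \<otimes>\<^bsub>T_alg X\<^esub> a) vs = (- 1) ^ p * T_cochain a vs"
    by blast
qed

lemma T_dg_algebra: "dg_algebra \<Z> (T_alg X) (T_grade X) (T_diff X)"
proof (intro dg_algebra.intro T_graded_algebra dg_algebra_axioms.intro)
  interpret ring "T_alg X" by (rule T_ring)
  fix a assume a: "a \<in> carrier (T_alg X)"
  show "T_diff X a \<in> carrier (T_alg X)"
    by (rule T_diff(1)[OF a])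
  show "T_diff X (T_diff X a) = \<zero>\<^bsub>T_alg X\<^esub>"
    by (rule T_cochain_inject[where X = X]) (simp_all add: T_diff a coboundary_coboundary)
  show "T_diff X (r \<odot>\<^bsub>T_alg X\<^esub> a) = r \<odot>\<^bsub>T_alg X\<^esub> T_diff X a" for r
  proof (rule T_cochain_inject[where X = X])
    fix vs
    have "T_cochain (r \<odot>\<^bsub>T_alg X\<^esub> a) = (\<lambda>vs. of_int r * T_cochain a vs)"
      by (simp add: T_smult_closed a fun_eq_iff)
    then show "T_cochain (T_diff X (r \<odot>\<^bsub>T_alg X\<^esub> a)) vs = T_cochain (r \<odot>\<^bsub>T_alg X\<^esub> T_diff X a) vs"
      by (simp add: T_smult_closed T_diff a coboundary_scale)
  qed (simp_all add: T_diff T_smult_closed a)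
  fix b assume b: "b \<in> carrier (T_alg X)"
  show "T_diff X (a \<oplus>\<^bsub>T_alg X\<^esub> b) = T_diff X a \<oplus>\<^bsub>T_alg X\<^esub> T_diff X b"
  proof (rule T_cochain_inject[where X = X])
    fix vs
    have "T_cochain (a \<oplus>\<^bsub>T_alg X\<^esub> b) = (\<lambda>vs. T_cochain a vs + T_cochain b vs)"
      by (simp add: T_cochain_add a b fun_eq_iff)
    then show "T_cochain (T_diff X (a \<oplus>\<^bsub>T_alg X\<^esub> b)) vs = T_cochain (T_diff X a \<oplus>\<^bsub>T_alg X\<^esub> T_diff X b) vs"
      by (simp add: T_cochain_add T_diff a b coboundary_add)
  qed (simp_all add: T_diff a b)
next
  fix p a assume "a \<in> T_grade X p"
  then show "T_diff X a \<in> T_grade X (p + 1)"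
    by (auto simp: T_grade_iff T_diff intro!: coboundary_length[of p])
next
  interpret ring "T_alg X" by (rule T_ring)
  fix p q a b assume ab: "a \<in> T_grade X p" "b \<in> T_grade X q"
  then have carr: "a \<in> carrier (T_alg X)" "b \<in> carrier (T_alg X)"
    by (simp_all add: T_grade_iff)
  show "T_diff X (a \<otimes>\<^bsub>T_alg X\<^esub> b) = T_diff X a \<otimes>\<^bsub>T_alg X\<^esub> b \<oplus>\<^bsub>T_alg X\<^esub>
      ((\<ominus>\<^bsub>T_alg X\<^esub> \<one>\<^bsub>T_alg X\<^esub>) [^]\<^bsub>T_alg X\<^esub> p) \<otimes>\<^bsub>T_alg X\<^esub> (a \<otimes>\<^bsub>T_alg X\<^esub> T_diff X b)"
  proof (rule T_cochain_inject[where X = X])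
    fix vs
    have mult: "T_cochain (a \<otimes>\<^bsub>T_alg X\<^esub> b) = cup (T_cochain a) (T_cochain b)"
      by (simp add: T_cochain_mult carr fun_eq_iff)
    have alt: "alternate (T_cochain a) = (\<lambda>vs. (- 1) ^ p * T_cochain a vs)"
      using ab(1) by (auto simp: alternate_def fun_eq_iff T_grade_iff)
    show "T_cochain (T_diff X (a \<otimes>\<^bsub>T_alg X\<^esub> b)) vs = T_cochain (T_diff X a \<otimes>\<^bsub>T_alg X\<^esub> b \<oplus>\<^bsub>T_alg X\<^esub>
        ((\<ominus>\<^bsub>T_alg X\<^esub> \<one>\<^bsub>T_alg X\<^esub>) [^]\<^bsub>T_alg X\<^esub> p) \<otimes>\<^bsub>T_alg X\<^esub> (a \<otimes>\<^bsub>T_alg X\<^esub> T_diff X b)) vs"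
      by (simp add: T_cochain_add T_diff carr T_sign)
        (simp add: T_cochain_mult T_diff carr mult coboundary_cup alt cup_scale_left)
  qed (simp_all add: T_diff carr)
qed

lemma cup_pair:
  assumes "\<And>vs. length vs \<noteq> 1 \<Longrightarrow> F vs = 0" "\<And>vs. length vs \<noteq> 1 \<Longrightarrow> G vs = 0"
  shows "cup F G vs = (case vs of [v, w] \<Rightarrow> F [v] * G [w] | _ \<Rightarrow> 0)"
proof (cases "length vs = 2")
  case True
  then obtain v w where "vs = [v, w]"
    by (auto simp: numeral_2_eq_2 length_Suc_conv)
  then show ?thesis
    using assms(1)[of "[]"] assms(1)[of "[v, w]"] by simp
next
  case False
  then have "cup F G vs = 0"
    using assms by (intro cup_length[of 1 F 1 G]) auto
  with False show ?thesis
    by (auto split: list.splits)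
qed

text \<open>An identity between elements of degree two only has to be checked on pairs of points.\<close>

lemma T_cochain_inject_2:
  assumes "U \<in> T_grade X 2" "V \<in> T_grade X 2" "\<And>v w. T_cochain U [v, w] = T_cochain V [v, w]"
  shows "U = V"
proof (rule T_cochain_inject[where X = X])
  fix vs show "T_cochain U vs = T_cochain V vs"
  proof (cases "length vs = 2")
    case True
    then show ?thesis
      using assms(3) by (auto simp: numeral_2_eq_2 length_Suc_conv)
  qed (use assms in \<open>auto simp: T_grade_iff\<close>)
qed (use assms in \<open>auto simp: T_grade_iff\<close>)

text \<open>An operation on classes is bilinear if the corresponding operation on cochains is.\<close>

lemma T_bilinear:
  assumes "M \<subseteq> carrier (T_alg X)" "N \<subseteq> carrier (T_alg X)" "P \<subseteq> carrier (T_alg X)"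
    and closed: "\<And>x y. x \<in> M \<Longrightarrow> y \<in> N \<Longrightarrow> h x y \<in> P"
    and h: "\<And>x y vs. x \<in> carrier (T_alg X) \<Longrightarrow> y \<in> carrier (T_alg X) \<Longrightarrow>
      h x y \<in> carrier (T_alg X) \<and> T_cochain (h x y) vs = H (T_cochain x) (T_cochain y) vs"
    and add: "\<And>F F' G vs. H (\<lambda>vs. F vs + F' vs) G vs = H F G vs + H F' G vs"
      "\<And>F F' G vs. H G (\<lambda>vs. F vs + F' vs) vs = H G F vs + H G F' vs"
    and scale: "\<And>c F G vs. H (\<lambda>vs. c * F vs) G vs = c * H F G vs"
      "\<And>c F G vs. H G (\<lambda>vs. c * F vs) vs = c * H G F vs"
  shows "bilinear_on \<Z> (T_alg X) M N P h"
proof -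
  interpret ring "T_alg X" by (rule T_ring)
  have co_add: "T_cochain (x \<oplus>\<^bsub>T_alg X\<^esub> y) = (\<lambda>vs. T_cochain x vs + T_cochain y vs)"
    if "x \<in> carrier (T_alg X)" "y \<in> carrier (T_alg X)" for x y
    using that by (simp add: fun_eq_iff T_cochain_add)
  have co_scale: "T_cochain (r \<odot>\<^bsub>T_alg X\<^esub> x) = (\<lambda>vs. of_int r * T_cochain x vs)"
    if "x \<in> carrier (T_alg X)" for x r
    using that by (simp add: fun_eq_iff T_smult_closed)
  note MN = subsetD[OF assms(1)] subsetD[OF assms(2)]
  show ?thesis
    unfolding bilinear_on_def
    by (intro conjI ballI closed T_cochain_inject[where X = X];
      simp add: MN h T_smult_closed co_add co_scale add scale)
qed

lemma T_cup_one_algebra: "cup_one_algebra \<Z> (T_alg X) (T_grade X) (T_cup1 X)"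
proof (intro cup_one_algebra.intro T_graded_algebra cup_one_algebra_axioms.intro)
  fix p :: nat assume p: "p \<in> {1, 2}"
  have lin: "cup1_cochain (\<lambda>vs. F vs + F' vs) G vs = cup1_cochain F G vs + cup1_cochain F' G vs"
    "cup1_cochain G (\<lambda>vs. F vs + F' vs) vs = cup1_cochain G F vs + cup1_cochain G F' vs"
    "cup1_cochain (\<lambda>vs. c * F vs) G vs = c * cup1_cochain F G vs"
    "cup1_cochain G (\<lambda>vs. c * F vs) vs = c * cup1_cochain G F vs"
    for F F' G c and vs :: "('a \<Rightarrow> int) list"
    by (cases "(F, F', vs)" rule: cup1_cochain.cases; simp add: algebra_simps)+
  show "bilinear_on \<Z> (T_alg X) (T_grade X p) (T_grade X 1) (T_grade X p) (T_cup1 X)"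
    by (rule T_bilinear[where H = cup1_cochain])
      (use p in \<open>auto simp: lin T_cup1 intro: T_cup1_grade\<close>, auto simp: T_grade_iff)
next
  interpret graded_algebra \<Z> "T_alg X" "T_grade X" by (rule T_graded_algebra)
  fix a b c assume abc: "a \<in> T_grade X 1" "b \<in> T_grade X 1" "c \<in> T_grade X 1"
  then have carr: "a \<in> carrier (T_alg X)" "b \<in> carrier (T_alg X)" "c \<in> carrier (T_alg X)"
    by (simp_all add: T_grade_iff)
  have mult: "x \<otimes>\<^bsub>T_alg X\<^esub> y \<in> T_grade X 2" if "x \<in> T_grade X 1" "y \<in> T_grade X 1" for x y
    using gr_mult[OF that] by simp
  have 1: "T_cup1 X x y \<in> T_grade X 1" if "x \<in> T_grade X 1" "y \<in> T_grade X 1" for x y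
    using that by (intro T_cup1_grade) auto
  have cup: "T_cochain (x \<otimes>\<^bsub>T_alg X\<^esub> y) [v, w] = T_cochain x [v] * T_cochain y [w]"
    if "x \<in> T_grade X 1" "y \<in> T_grade X 1" for x y v w
    using that by (simp add: T_grade_iff T_cochain_mult cup_pair)
  show "T_cup1 X (a \<otimes>\<^bsub>T_alg X\<^esub> b) c =
      a \<otimes>\<^bsub>T_alg X\<^esub> T_cup1 X b c \<oplus>\<^bsub>T_alg X\<^esub> T_cup1 X a c \<otimes>\<^bsub>T_alg X\<^esub> b"
  proof (rule T_cochain_inject_2)
    show "T_cup1 X (a \<otimes>\<^bsub>T_alg X\<^esub> b) c \<in> T_grade X 2"
      by (intro T_cup1_grade mult abc) simp
    show "a \<otimes>\<^bsub>T_alg X\<^esub> T_cup1 X b c \<oplus>\<^bsub>T_alg X\<^esub> T_cup1 X a c \<otimes>\<^bsub>T_alg X\<^esub> b \<in> T_grade X 2"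
      by (intro T_grade_closed mult abc 1)
    show "T_cochain (T_cup1 X (a \<otimes>\<^bsub>T_alg X\<^esub> b) c) [v, w] = T_cochain
        (a \<otimes>\<^bsub>T_alg X\<^esub> T_cup1 X b c \<oplus>\<^bsub>T_alg X\<^esub> T_cup1 X a c \<otimes>\<^bsub>T_alg X\<^esub> b) [v, w]" for v w
      by (simp add: T_cup1 carr T_cochain_add cup abc 1 algebra_simps)
  qed
qed (rule T_unit_cring)

text \<open>The formula for the differential of a cup-one product says that translation is
  multiplicative.\<close>

theorem T_cup_one_dga:
  "cup_one_dga \<Z> (T_alg X) (T_grade X) (T_diff X) (T_cup1 X) (T_circ X)"
proof (intro cup_one_dga.intro T_dg_algebra T_cup_one_algebra cup_one_dga_axioms.intro)
  interpret graded_algebra \<Z> "T_alg X" "T_grade X" by (rule T_graded_algebra)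
  have circ_grade: "T_circ X U V \<in> T_grade X 2"
    if "U \<in> carrier (T_alg X)" "V \<in> carrier (T_alg X)" for U V
  proof -
    have "circ_cochain F G vs = 0" if "length vs \<noteq> 2" for F G and vs :: "('a \<Rightarrow> int) list"
      using that by (cases "(F, G, vs)" rule: circ_cochain.cases) auto
    with that show ?thesis
      by (simp add: T_grade_iff T_circ)
  qed
  have carrier: "x \<in> carrier (T_alg X)" if "x \<in> T_grade X n" for x n
    using that by (simp add: T_grade_iff)
  have mult: "x \<otimes>\<^bsub>T_alg X\<^esub> y \<in> T_grade X 2" if "x \<in> T_grade X 1" "y \<in> T_grade X 1" for x y
    using gr_mult[OF that] by simp
  have 1: "T_cup1 X x y \<in> T_grade X 1" if "x \<in> T_grade X 1" "y \<in> T_grade X 1" for x y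
    using that by (intro T_cup1_grade) auto
  have cup: "T_cochain (x \<otimes>\<^bsub>T_alg X\<^esub> y) [v, w] = T_cochain x [v] * T_cochain y [w]"
    if "x \<in> T_grade X 1" "y \<in> T_grade X 1" for x y v w
    using that by (simp add: T_grade_iff T_cochain_mult cup_pair)
  have lin: "circ_cochain (\<lambda>vs. F vs + F' vs) G vs = circ_cochain F G vs + circ_cochain F' G vs"
    "circ_cochain G (\<lambda>vs. F vs + F' vs) vs = circ_cochain G F vs + circ_cochain G F' vs"
    "circ_cochain (\<lambda>vs. c * F vs) G vs = c * circ_cochain F G vs"
    "circ_cochain G (\<lambda>vs. c * F vs) vs = c * circ_cochain G F vs"
    for F F' G c and vs :: "('a \<Rightarrow> int) list"
    by (cases "(F, F', vs)" rule: circ_cochain.cases; simp add: algebra_simps)+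
  show "bilinear_on \<Z> (T_alg X) D2 D2 D2 (T_circ X)"
    unfolding T_D2
    by (rule T_bilinear[where H = circ_cochain])
      (auto simp: lin T_circ intro: circ_grade carrier)
  show "T_circ X (u \<otimes>\<^bsub>T_alg X\<^esub> v) (w \<otimes>\<^bsub>T_alg X\<^esub> z) =
      T_cup1 X u w \<otimes>\<^bsub>T_alg X\<^esub> T_cup1 X v z"
    if "u \<in> T_grade X 1" "v \<in> T_grade X 1" "w \<in> T_grade X 1" "z \<in> T_grade X 1" for u v w z
    using that carrier[OF that(1)] carrier[OF that(2)] carrier[OF that(3)] carrier[OF that(4)]
    by (intro T_cochain_inject_2[where X = X] circ_grade mult 1) (simp_all add: T_circ cup 1 T_cup1)
  fix a b assume ab: "a \<in> T_grade X 1" "b \<in> T_grade X 1"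
  note carr = carrier[OF ab(1)] carrier[OF ab(2)]
  have d2: "T_diff X a \<in> T_grade X 2" "T_diff X b \<in> T_grade X 2"
    "T_diff X (T_cup1 X a b) \<in> T_grade X 2"
    using dg_algebra.d_degree[OF T_dg_algebra, of _ X 1] ab 1 by simp_all
  note carr' = carrier[OF d2(1)] carrier[OF d2(2)]
  show "T_diff X (T_cup1 X a b) =
      (\<ominus>\<^bsub>T_alg X\<^esub> (a \<otimes>\<^bsub>T_alg X\<^esub> b)) \<ominus>\<^bsub>T_alg X\<^esub> b \<otimes>\<^bsub>T_alg X\<^esub> a
        \<oplus>\<^bsub>T_alg X\<^esub> T_cup1 X (T_diff X a) b \<oplus>\<^bsub>T_alg X\<^esub> T_cup1 X (T_diff X b) a
        \<ominus>\<^bsub>T_alg X\<^esub> T_circ X (T_diff X a) (T_diff X b)" (is "_ = ?rhs")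
  proof (rule T_cochain_inject_2[OF d2(3)])
    have diff: "x \<ominus>\<^bsub>T_alg X\<^esub> y \<in> T_grade X 2" if "x \<in> T_grade X 2" "y \<in> T_grade X 2" for x y
      using that by (simp add: a_minus_def T_grade_closed)
    show "?rhs \<in> T_grade X 2"
      by (intro diff T_grade_closed mult ab circ_grade carr' T_cup1_grade d2) auto
    fix v w
    (* Both sides are a(v) b(v) + a(w) b(w) - a(v + w) b(v + w): on the right, expand the product of
       the two identities a(v + w) = a(v) + a(w) - (d a)(v, w) and
       b(v + w) = b(v) + b(w) - (d b)(v, w). *)
    show "T_cochain (T_diff X (T_cup1 X a b)) [v, w] = T_cochain ?rhs [v, w]"
      by (simp add: T_diff T_cup1 T_circ T_cochain_add T_cochain_diff T_cochain_minus carr carr' cup ab algebra_simps)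
  qed
qed

theorem theorem7p2:
  fixes X :: "'x set"
  shows "\<exists>d. binomial_cup_one_dga \<Z> (T_alg X) (T_grade X) d (T_cup1 X) (T_circ X) \<and>
             (\<forall>x\<in>X. d (T_incl X (Var x)) = \<zero>\<^bsub>T_alg X\<^esub>)"
proof (intro exI conjI ballI)
  show "binomial_cup_one_dga \<Z> (T_alg X) (T_grade X) (T_diff X) (T_cup1 X) (T_circ X)"
    by (intro binomial_cup_one_dga.intro T_cup_one_dga binomial_cup_one_dga_axioms.intro
        binomial_ring_int T_unit_binomial)
  fix x assume "x \<in> X"
  then have x: "Var x \<in> m_ideal X"
    by (simp add: m_ideal_iff Int_poly_Var)
  interpret ring "T_alg X" by (rule T_ring)
  have grade: "T_incl X (Var x) \<in> carrier (T_alg X)"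
    using T_incl(1)[OF x] by (simp add: T_grade_iff)
  show "T_diff X (T_incl X (Var x)) = \<zero>\<^bsub>T_alg X\<^esub>"
  proof (rule T_cochain_inject_2)
    show "T_diff X (T_incl X (Var x)) \<in> T_grade X 2"
      using dg_algebra.d_degree[OF T_dg_algebra T_incl(1)[OF x]] by simp
    show "T_cochain (T_diff X (T_incl X (Var x))) [v, w] = T_cochain \<zero>\<^bsub>T_alg X\<^esub> [v, w]" for v w
      by (simp add: T_diff grade T_incl(2)[OF x])
  qed (rule T_grade_closed)
qed

end
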